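(* Let $\Gamma=(V,E)$ be a finite connected simple undirected graph, let $B\subsetneq V$ be a set of $m\geq 2$ vertices, no two of which are adjacent, and let $u:B\to\mathbb{R}$ be injective. Let $\widehat{\Gamma}$ be the graph obtained from $\Gamma$ by adding an edge between each pair of elements of $B$. The number of semicompatible orientations of $(\Gamma,u)$ is $$\frac{\alpha(\widehat{\Gamma})}{m!},$$ where $\alpha(\widehat{\Gamma})$ is the number of acyclic orientations of $\widehat{\Gamma}$. The number of compatible orientations of $(\Gamma,u)$ is $$\frac{\beta(\widehat{\Gamma})}{(m-2)!},$$ where $\beta(\widehat{\Gamma})$ is the beta invariant of $\widehat{\Gamma}$.
   Context: An orientation $\sigma$ of $\Gamma$ respects $u$ if for any directed path from $i$ to $j$ in $\sigma$ between distinct elements $i,j\in B$ we have $u(i)>u(j)$. An orientation of $\Gamma$ is semicompatible (with respect to $(\Gamma,u)$) if it is acyclic and respects $u$. It is compatible if it is semicompatible and has no sinks or sources in $V\setminus B$. The beta invariant of a graph $\Delta$ with chromatic polynomial $\chi_\Delta$ is $\beta(\Delta)=|\chi_\Delta'(1)|$, where $\chi_\Delta'$ is the derivative. *)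

theory Defs
  imports
    "HOL-Computational_Algebra.Polynomial"
    "HOL-Library.FuncSet"
    "Graph_Theory.Graph_Theory"
begin

text \<open>
  As in \<^theory>\<open>Graph_Theory.Pair_Digraph\<close>, a finite simple undirected graph is a loop-free finite
  symmetric digraph (\<^const>\<open>pair_graph\<close>): an edge between \<open>i\<close> and \<open>j\<close> is the two arcs \<open>(i, j)\<close> and \<open>(j, i)\<close>.
\<close>

definition proper_colorings :: "'a pair_pre_digraph \<Rightarrow> nat \<Rightarrow> ('a \<Rightarrow> nat) set" where
  "proper_colorings G k =
     {c \<in> pverts G \<rightarrow>\<^sub>E {..<k}. \<forall>(i, j) \<in> parcs G. c i \<noteq> c j}"

definition chromatic_poly :: "'a pair_pre_digraph \<Rightarrow> real poly" where
  "chromatic_poly G =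
     (THE p. \<forall>k. poly p (of_nat k) = of_nat (card (proper_colorings G k)))"

definition beta_invariant :: "'a pair_pre_digraph \<Rightarrow> real" where
  "beta_invariant G = \<bar>poly (pderiv (chromatic_poly G)) 1\<bar>"

text \<open>An orientation is the set of its arcs: it contains exactly one of the two arcs of every edge.\<close>

definition orientations :: "'a pair_pre_digraph \<Rightarrow> 'a rel set" where
  "orientations G =
     {D. D \<subseteq> parcs G \<and> (\<forall>(i, j) \<in> parcs G. (i, j) \<in> D \<longleftrightarrow> (j, i) \<notin> D)}"

definition acyclic_orientations :: "'a pair_pre_digraph \<Rightarrow> 'a rel set" where
  "acyclic_orientations G = {D \<in> orientations G. acyclic D}"

definition respects_values :: "'a rel \<Rightarrow> 'a set \<Rightarrow> ('a \<Rightarrow> real) \<Rightarrow> bool" where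
  "respects_values D B u \<longleftrightarrow>
     (\<forall>i \<in> B. \<forall>j \<in> B. i \<noteq> j \<longrightarrow> (i, j) \<in> D\<^sup>+ \<longrightarrow> u i > u j)"

definition semicompatible_orientations ::
  "'a pair_pre_digraph \<Rightarrow> 'a set \<Rightarrow> ('a \<Rightarrow> real) \<Rightarrow> 'a rel set" where
  "semicompatible_orientations G B u =
     {D \<in> orientations G. acyclic D \<and> respects_values D B u}"

definition is_sink :: "'a rel \<Rightarrow> 'a \<Rightarrow> bool" where
  "is_sink D v \<longleftrightarrow> (\<forall>w. (v, w) \<notin> D)"

definition is_source :: "'a rel \<Rightarrow> 'a \<Rightarrow> bool" where
  "is_source D v \<longleftrightarrow> (\<forall>w. (w, v) \<notin> D)"

definition compatible_orientations ::
  "'a pair_pre_digraph \<Rightarrow> 'a set \<Rightarrow> ('a \<Rightarrow> real) \<Rightarrow> 'a rel set" where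
  "compatible_orientations G B u =
     {D \<in> semicompatible_orientations G B u.
        \<forall>v \<in> pverts G - B. \<not> is_sink D v \<and> \<not> is_source D v}"

definition add_clique :: "'a pair_pre_digraph \<Rightarrow> 'a set \<Rightarrow> 'a pair_pre_digraph" where
  "add_clique G B =
     \<lparr> pverts = pverts G, parcs = parcs G \<union> {(i, j). i \<in> B \<and> j \<in> B \<and> i \<noteq> j} \<rparr>"


text \<open>The definite description in \<open>chromatic_poly\<close> is meaningful: such a polynomial exists and is unique.\<close>

lemma card_proper_colorings_image:
  assumes wf: "\<And>i j. (i, j) \<in> parcs G \<Longrightarrow> i \<in> pverts G \<and> j \<in> pverts G"
    and A: "A \<subseteq> {..<k}"
  shows "card {c \<in> proper_colorings G k. c ` pverts G = A}
       = card {c \<in> proper_colorings G (card A). c ` pverts G = {..<card A}}"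
proof -
  let ?V = "pverts G"
  have "finite A" by (rule finite_subset[OF A]) simp
  then obtain h where h: "bij_betw h {..<card A} A"
    using ex_bij_betw_nat_finite[of A] unfolding atLeast0LessThan by blast
  define g where "g = inv_into {..<card A} h"
  have gh: "g (h x) = x" if "x \<in> {..<card A}" for x
    unfolding g_def by (rule bij_betw_inv_into_left[OF h that])
  have hg: "h (g x) = x" if "x \<in> A" for x
    unfolding g_def by (rule bij_betw_inv_into_right[OF h that])
  have hA: "h ` {..<card A} = A"
    by (rule bij_betw_imp_surj_on[OF h])
  have gA: "g ` A = {..<card A}"
    unfolding g_def by (rule bij_betw_imp_surj_on[OF bij_betw_inv_into[OF h]])
  let ?L = "{c \<in> proper_colorings G k. c ` ?V = A}"
  let ?R = "{c \<in> proper_colorings G (card A). c ` ?V = {..<card A}}"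
  have transfer: "restrict (f \<circ> c) ?V \<in> proper_colorings G l \<and> restrict (f \<circ> c) ?V ` ?V = Y
      \<and> restrict (f' \<circ> restrict (f \<circ> c) ?V) ?V = c"
    if c: "c \<in> proper_colorings G k'" "c ` ?V = X" and f: "f ` X = Y" and Y: "Y \<subseteq> {..<l}"
      and inv: "\<And>x. x \<in> X \<Longrightarrow> f' (f x) = x"
    for c f f' X Y k' l
  proof (intro conjI)
    have cX: "c v \<in> X" if "v \<in> ?V" for v
      unfolding c(2)[symmetric] using that by (rule imageI)
    have im: "restrict (f \<circ> c) ?V ` ?V = f ` (c ` ?V)"
      by (simp add: image_image)
    then show imY: "restrict (f \<circ> c) ?V ` ?V = Y"
      by (simp only: c(2) f)
    have edge: "restrict (f \<circ> c) ?V i \<noteq> restrict (f \<circ> c) ?V j" if e: "(i, j) \<in> parcs G" for i j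
    proof
      assume eq: "restrict (f \<circ> c) ?V i = restrict (f \<circ> c) ?V j"
      have ij: "i \<in> ?V" "j \<in> ?V" using wf[OF e] by blast+
      then have "f' (f (c i)) = f' (f (c j))" using eq by simp
      then have "c i = c j"
        unfolding inv[OF cX[OF ij(1)]] inv[OF cX[OF ij(2)]] .
      then show False using c(1) e unfolding proper_colorings_def by blast
    qed
    have "(f \<circ> c) v \<in> {..<l}" if "v \<in> ?V" for v
      unfolding o_apply
      by (rule subsetD[OF Y], unfold f[symmetric], rule imageI, rule cX[OF that])
    then have "restrict (f \<circ> c) ?V \<in> ?V \<rightarrow>\<^sub>E {..<l}"
      by (rule restrict_PiE_iff[THEN iffD2, rule_format])
    with edge show "restrict (f \<circ> c) ?V \<in> proper_colorings G l"
      unfolding proper_colorings_def by blast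
    show "restrict (f' \<circ> restrict (f \<circ> c) ?V) ?V = c"
    proof
      fix v
      show "restrict (f' \<circ> restrict (f \<circ> c) ?V) ?V v = c v"
      proof (cases "v \<in> ?V")
        case True
        then show ?thesis using inv[OF cX] by simp
      next
        case False
        moreover have "c \<in> extensional ?V"
          using c(1) by (simp add: proper_colorings_def PiE_def)
        ultimately show ?thesis by (simp add: extensional_def)
      qed
    qed
  qed
  have "bij_betw (\<lambda>c. restrict (g \<circ> c) ?V) ?L ?R"
  proof (rule bij_betw_byWitness[where f' = "\<lambda>c. restrict (h \<circ> c) ?V"])
    have L: "restrict (g \<circ> c) ?V \<in> ?R \<and> restrict (h \<circ> restrict (g \<circ> c) ?V) ?V = c"
      if "c \<in> ?L" for c
    proof -
      from that have "c \<in> proper_colorings G k" "c ` ?V = A" by blast+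
      from transfer[OF this gA order_refl hg] show ?thesis by blast
    qed
    have R: "restrict (h \<circ> c) ?V \<in> ?L \<and> restrict (g \<circ> restrict (h \<circ> c) ?V) ?V = c"
      if "c \<in> ?R" for c
    proof -
      from that have "c \<in> proper_colorings G (card A)" "c ` ?V = {..<card A}" by blast+
      from transfer[OF this hA A gh] show ?thesis by blast
    qed
    show "\<forall>c\<in>?L. restrict (h \<circ> restrict (g \<circ> c) ?V) ?V = c"
      by (rule ballI, rule L[THEN conjunct2])
    show "\<forall>c\<in>?R. restrict (g \<circ> restrict (h \<circ> c) ?V) ?V = c"
      by (rule ballI, rule R[THEN conjunct2])
    show "(\<lambda>c. restrict (g \<circ> c) ?V) ` ?L \<subseteq> ?R"
      by (rule image_subsetI, rule L[THEN conjunct1])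
    show "(\<lambda>c. restrict (h \<circ> c) ?V) ` ?R \<subseteq> ?L"
      by (rule image_subsetI, rule R[THEN conjunct1])
  qed
  then show ?thesis by (rule bij_betw_same_card)
qed

lemma ex1_chromatic_poly:
  assumes fin: "finite (pverts G)"
    and wf: "\<And>i j. (i, j) \<in> parcs G \<Longrightarrow> i \<in> pverts G \<and> j \<in> pverts G"
  shows "\<exists>!p :: real poly. \<forall>k. poly p (of_nat k) = of_nat (card (proper_colorings G k))"
proof (rule ex_ex1I)
  let ?V = "pverts G"
  define s where "s j = card {c \<in> proper_colorings G j. c ` ?V = {..<j}}" for j
  have s0: "s j = 0" if "j > card ?V" for j
  proof -
    have "c ` ?V \<noteq> {..<j}" for c
      using card_image_le[OF fin, of c] that by auto
    then show ?thesis by (simp add: s_def)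
  qed
  have finP: "finite (proper_colorings G k)" for k
    unfolding proper_colorings_def
    by (rule finite_subset[of _ "?V \<rightarrow>\<^sub>E {..<k}"]) (auto intro: finite_PiE fin)
  have cnt: "card (proper_colorings G k) = (\<Sum>j\<le>card ?V. (k choose j) * s j)" for k
  proof -
    have "card (proper_colorings G k)
        = (\<Sum>A\<in>Pow {..<k}. card {c \<in> proper_colorings G k. c ` ?V = A})"
    proof -
      have "proper_colorings G k = (\<Union>A\<in>Pow {..<k}. {c \<in> proper_colorings G k. c ` ?V = A})"
        by (auto simp: proper_colorings_def)
      also have "card \<dots> = (\<Sum>A\<in>Pow {..<k}. card {c \<in> proper_colorings G k. c ` ?V = A})"
        by (rule card_UN_disjoint) (use finP in auto)
      finally show ?thesis .
    qed
    also have "\<dots> = (\<Sum>A\<in>Pow {..<k}. s (card A))"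
      unfolding s_def
      by (intro sum.cong refl card_proper_colorings_image[OF wf]) auto
    also have "\<dots> = (\<Sum>j\<le>k. \<Sum>A\<in>{A \<in> Pow {..<k}. card A = j}. s (card A))"
    proof (rule sum.group[symmetric])
      show "card ` Pow {..<k} \<subseteq> {..k}"
      proof (rule image_subsetI)
        fix A assume "A \<in> Pow {..<k}"
        then have "card A \<le> card {..<k}" by (intro card_mono) simp_all
        then show "card A \<in> {..k}" by simp
      qed
    qed auto
    also have "\<dots> = (\<Sum>j\<le>k. (k choose j) * s j)"
    proof (rule sum.cong[OF refl])
      fix j
      have "(\<Sum>A\<in>{A \<in> Pow {..<k}. card A = j}. s (card A)) = card {A. A \<subseteq> {..<k} \<and> card A = j} * s j"
        by simp
      then show "(\<Sum>A\<in>{A \<in> Pow {..<k}. card A = j}. s (card A)) = (k choose j) * s j"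
        using n_subsets[of "{..<k}" j] by simp
    qed
    also have "\<dots> = (\<Sum>j\<le>k + card ?V. (k choose j) * s j)"
      by (rule sum.mono_neutral_left) auto
    also have "\<dots> = (\<Sum>j\<le>card ?V. (k choose j) * s j)"
      by (rule sum.mono_neutral_right) (auto simp: s0)
    finally show ?thesis .
  qed
  define p :: "real poly" where
    "p = (\<Sum>j\<le>card ?V. smult (real (s j) / fact j) (\<Prod>i=0..<j. [:- real i, 1:]))"
  have choose: "real (k choose j) = (\<Prod>i=0..<j. real k - real i) / fact j" for k j
    unfolding binomial_gbinomial gbinomial_prod_rev by simp
  have "poly p (of_nat k) = of_nat (card (proper_colorings G k))" for k
  proof -
    have "poly p (real k) = (\<Sum>j\<le>card ?V. real (s j) / fact j * (\<Prod>i=0..<j. real k - real i))"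
      by (simp add: p_def poly_sum poly_prod)
    also have "\<dots> = (\<Sum>j\<le>card ?V. real (k choose j) * real (s j))"
      by (rule sum.cong[OF refl]) (simp add: choose)
    finally show ?thesis by (simp only: cnt of_nat_sum of_nat_mult)
  qed
  then show "\<exists>p :: real poly. \<forall>k. poly p (of_nat k) = of_nat (card (proper_colorings G k))"
    by blast
next
  fix p q :: "real poly"
  assume "\<forall>k. poly p (of_nat k) = of_nat (card (proper_colorings G k))"
    "\<forall>k. poly q (of_nat k) = of_nat (card (proper_colorings G k))"
  then have sub: "range (of_nat :: nat \<Rightarrow> real) \<subseteq> {x. poly (p - q) x = 0}" by auto
  have "infinite (range (of_nat :: nat \<Rightarrow> real))"
    by (simp add: finite_image_iff inj_on_def)
  then have "infinite {x. poly (p - q) x = 0}" using sub finite_subset by blast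
  then have "p - q = 0" using poly_roots_finite by blast
  then show "p = q" by simp
qed

end

theory Submission
  imports Defs
begin

text \<open>
  Adding the arcs from larger to smaller values of \<open>u\<close> on \<open>B\<close> identifies the semicompatible orientations
  of \<open>\<Gamma>\<close> with the acyclic orientations of \<open>\<Gamma>\<close> plus the clique on \<open>B\<close> that are decreasing along
  \<open>u\<close> on the clique. For any graph containing the clique, the number of these orientations, and the number of
  those without sinks and sources outside \<open>B\<close>, satisfies deletion-contraction for the edges not contained
  in \<open>B\<close>; so do, up to sign, the values \<open>\<chi>(-1)\<close> and \<open>\<chi>'(1)\<close> of the chromatic polynomial. The
  factors \<open>m!\<close> and \<open>(m - 2)!\<close> come from the complete graph on \<open>B\<close>, where there is exactly one such
  orientation. Taking the empty clique gives Stanley's theorem \<open>\<alpha> = \<bar>\<chi>(-1)\<bar>\<close>.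
\<close>

subsection \<open>Deletion and contraction\<close>

text \<open>A locale-free form, with which the axioms can be checked for modified graphs by plain
  reasoning about sets.\<close>

lemma pair_graph_iff:
  "pair_graph G \<longleftrightarrow> finite (pverts G) \<and> parcs G \<subseteq> pverts G \<times> pverts G \<and> sym (parcs G) \<and> irrefl (parcs G)"
proof
  assume "pair_graph G"
  then interpret pair_graph G .
  show "finite (pverts G) \<and> parcs G \<subseteq> pverts G \<times> pverts G \<and> sym (parcs G) \<and> irrefl (parcs G)"
    using pair_finite_verts pair_sym_arcs no_loops' in_arcsD1 in_arcsD2
    by (auto simp: symmetric_def irrefl_def)
next
  assume a: "finite (pverts G) \<and> parcs G \<subseteq> pverts G \<times> pverts G \<and> sym (parcs G) \<and> irrefl (parcs G)"
  then have "finite (parcs G)" by (auto intro: finite_subset)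
  with a show "pair_graph G"
    by unfold_locales (auto simp: symmetric_def irrefl_def)
qed

definition delete_edge :: "'a pair_pre_digraph \<Rightarrow> 'a \<Rightarrow> 'a \<Rightarrow> 'a pair_pre_digraph" where
  "delete_edge G v w = \<lparr> pverts = pverts G, parcs = parcs G - {(v, w), (w, v)} \<rparr>"

definition merge :: "'a \<Rightarrow> 'a \<Rightarrow> 'a \<Rightarrow> 'a" where
  "merge v w x = (if x = w then v else x)"

text \<open>The vertex \<open>w\<close> is absorbed into \<open>v\<close>. Both arcs of the edge are
  removed before taking the image, so that no loop arises; parallel edges are identified because the
  arcs form a set.\<close>

definition contract_edge :: "'a pair_pre_digraph \<Rightarrow> 'a \<Rightarrow> 'a \<Rightarrow> 'a pair_pre_digraph" where
  "contract_edge G v w =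
     \<lparr> pverts = pverts G - {w}, parcs = map_prod (merge v w) (merge v w) ` (parcs G - {(v, w), (w, v)}) \<rparr>"

definition delete_vertex :: "'a pair_pre_digraph \<Rightarrow> 'a \<Rightarrow> 'a pair_pre_digraph" where
  "delete_vertex G w = \<lparr> pverts = pverts G - {w}, parcs = {(i, j) \<in> parcs G. i \<noteq> w \<and> j \<noteq> w} \<rparr>"

lemma pair_graph_delete_edge: "pair_graph G \<Longrightarrow> pair_graph (delete_edge G v w)"
  unfolding pair_graph_iff delete_edge_def by (auto simp: sym_def irrefl_def)

lemma pair_graph_delete_vertex: "pair_graph G \<Longrightarrow> pair_graph (delete_vertex G w)"
  unfolding pair_graph_iff delete_vertex_def by (auto simp: sym_def irrefl_def)

lemma parcs_delete_edge_iff: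
  "(i, j) \<in> parcs (delete_edge G v w) \<longleftrightarrow> (i, j) \<in> parcs G \<and> (i, j) \<noteq> (v, w) \<and> (i, j) \<noteq> (w, v)"
  by (simp add: delete_edge_def)

lemma parcs_contract_edge:
  "parcs (contract_edge G v w) = map_prod (merge v w) (merge v w) ` parcs (delete_edge G v w)"
  by (simp add: contract_edge_def delete_edge_def)

lemma parcs_contract_edgeI:
  "(i, j) \<in> parcs (delete_edge G v w) \<Longrightarrow> (merge v w i, merge v w j) \<in> parcs (contract_edge G v w)"
  unfolding parcs_contract_edge by (rule image_eqI[where x = "(i, j)"]) auto

lemma parcs_contract_edgeE:
  assumes "(a, b) \<in> parcs (contract_edge G v w)"
  obtains i j where "(i, j) \<in> parcs (delete_edge G v w)" "a = merge v w i" "b = merge v w j"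
  using assms unfolding parcs_contract_edge by auto

lemma pair_graph_contract_edge:
  assumes "pair_graph G" "(v, w) \<in> parcs G"
  shows "pair_graph (contract_edge G v w)"
proof -
  have v: "v \<in> pverts G" "v \<noteq> w" using assms by (auto simp: pair_graph_iff irrefl_def)
  have H: "(i, j) \<in> parcs (delete_edge G v w) \<Longrightarrow> (j, i) \<in> parcs (delete_edge G v w) \<and> i \<in> pverts G \<and> j \<in> pverts G \<and> i \<noteq> j"
    for i j
    using pair_graph_delete_edge[OF assms(1), of v w] by (auto simp: pair_graph_iff sym_def irrefl_def delete_edge_def)
  have "(b, a) \<in> parcs (contract_edge G v w) \<and> a \<in> pverts G - {w} \<and> b \<in> pverts G - {w} \<and> a \<noteq> b"
    if "(a, b) \<in> parcs (contract_edge G v w)" for a b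
  proof -
    from that obtain i j where ij: "(i, j) \<in> parcs (delete_edge G v w)" "a = merge v w i" "b = merge v w j"
      by (rule parcs_contract_edgeE)
    have "(b, a) \<in> parcs (contract_edge G v w)"
      unfolding ij by (rule parcs_contract_edgeI) (use H[OF ij(1)] in blast)
    moreover have "a \<noteq> b"
      using ij H[OF ij(1)] by (auto simp: merge_def parcs_delete_edge_iff split: if_splits)
    ultimately show ?thesis using ij v H[OF ij(1)] by (auto simp: merge_def)
  qed
  then show ?thesis using assms(1)
    unfolding pair_graph_iff sym_def irrefl_def by (auto simp: contract_edge_def)
qed

subsection \<open>Chromatic polynomials\<close>

lemma poly_chromatic_poly:
  assumes "pair_graph G"
  shows "poly (chromatic_poly G) (of_nat k) = of_nat (card (proper_colorings G k))"
proof -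
  have "\<exists>!p :: real poly. \<forall>k. poly p (of_nat k) = of_nat (card (proper_colorings G k))"
    using assms by (intro ex1_chromatic_poly) (auto simp: pair_graph_iff)
  from theI'[OF this] show ?thesis unfolding chromatic_poly_def by blast
qed

text \<open>Reduces identities between chromatic polynomials to counting colorings for every number
  \<open>k\<close> of colors.\<close>

lemma chromatic_poly_eqI:
  assumes "pair_graph G" "\<And>k. poly p (of_nat k) = of_nat (card (proper_colorings G k))"
  shows "chromatic_poly G = p"
proof -
  have "\<exists>!p :: real poly. \<forall>k. poly p (of_nat k) = of_nat (card (proper_colorings G k))"
    using assms(1) by (intro ex1_chromatic_poly) (auto simp: pair_graph_iff)
  from the1_equality[OF this] assms(2) show ?thesis unfolding chromatic_poly_def by blast
qed

lemma proper_colorings_iff: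
  "c \<in> proper_colorings G k \<longleftrightarrow> c \<in> pverts G \<rightarrow>\<^sub>E {..<k} \<and> (\<forall>i j. (i, j) \<in> parcs G \<longrightarrow> c i \<noteq> c j)"
  unfolding proper_colorings_def by auto

lemma finite_proper_colorings: "finite (pverts G) \<Longrightarrow> finite (proper_colorings G k)"
  unfolding proper_colorings_def
  by (rule finite_subset[of _ "pverts G \<rightarrow>\<^sub>E {..<k}"]) (auto intro: finite_PiE)

text \<open>A proper coloring of the graph without the edge either separates \<open>v\<close> and
  \<open>w\<close>, and is then proper for \<open>G\<close>, or gives them the same color, and then
  descends to the contraction.\<close>

lemma card_proper_colorings_delete_contract:
  assumes G: "pair_graph G" and e: "(v, w) \<in> parcs G"
  shows "card (proper_colorings (delete_edge G v w) k)
       = card (proper_colorings G k) + card (proper_colorings (contract_edge G v w) k)"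
proof -
  let ?H = "delete_edge G v w" and ?K = "contract_edge G v w"
  have vw: "v \<in> pverts G" "w \<in> pverts G" "v \<noteq> w" "(w, v) \<in> parcs G"
    using assms by (auto simp: pair_graph_iff irrefl_def sym_def)
  have wf: "i \<in> pverts G \<and> j \<in> pverts G" if "(i, j) \<in> parcs G" for i j
    using G that by (auto simp: pair_graph_iff)
  let ?S = "{c \<in> proper_colorings ?H k. c v = c w}"
  have fin: "finite (proper_colorings ?H k)" "finite (proper_colorings G k)"
    using G by (auto intro!: finite_proper_colorings simp: pair_graph_iff delete_edge_def)
  have split: "proper_colorings ?H k = proper_colorings G k \<union> ?S"
    using e vw by (auto simp: proper_colorings_def delete_edge_def)
  have "proper_colorings G k \<inter> ?S = {}"
    using e by (auto simp: proper_colorings_def)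
  then have "card (proper_colorings ?H k) = card (proper_colorings G k) + card ?S"
    using fin by (subst split, subst card_Un_disjoint) auto
  \<comment> \<open>Colorings are extensional functions, so dropping the vertex \<open>w\<close>
    means resetting its value to \<open>undefined\<close>; the lost color is recovered as that of
    \<open>v\<close>.\<close>
  moreover have "bij_betw (\<lambda>c. c(w := undefined)) ?S (proper_colorings ?K k)"
  proof (rule bij_betw_byWitness[where f' = "\<lambda>c. c(w := c v)"])
    show "\<forall>c\<in>?S. (c(w := undefined))(w := (c(w := undefined)) v) = c" using vw by auto
    show "\<forall>c\<in>proper_colorings ?K k. (c(w := c v))(w := undefined) = c"
      by (auto simp: proper_colorings_def contract_edge_def PiE_def extensional_def)
    show "(\<lambda>c. c(w := undefined)) ` ?S \<subseteq> proper_colorings ?K k"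
    proof (rule image_subsetI)
      fix c assume c: "c \<in> ?S"
      define d where "d = c(w := undefined)"
      have d: "d (merge v w x) = c x" for x using c vw by (auto simp: d_def merge_def)
      have "d a \<noteq> d b" if "(a, b) \<in> parcs ?K" for a b
      proof -
        from that obtain i j where ij: "(i, j) \<in> parcs ?H" "a = merge v w i" "b = merge v w j"
          by (rule parcs_contract_edgeE)
        then show ?thesis using c by (simp add: d proper_colorings_iff)
      qed
      moreover have "d \<in> pverts ?K \<rightarrow>\<^sub>E {..<k}"
        using c by (auto simp: d_def proper_colorings_iff delete_edge_def contract_edge_def PiE_iff extensional_def)
      ultimately show "d \<in> proper_colorings ?K k"
        unfolding proper_colorings_iff by simp
    qed
    show "(\<lambda>c. c(w := c v)) ` proper_colorings ?K k \<subseteq> ?S"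
    proof (rule image_subsetI)
      fix c assume c: "c \<in> proper_colorings ?K k"
      define d where "d = c(w := c v)"
      have d: "d x = c (merge v w x)" for x by (simp add: d_def merge_def)
      have "d i \<noteq> d j" if "(i, j) \<in> parcs ?H" for i j
        using parcs_contract_edgeI[OF that] c by (simp add: d proper_colorings_iff)
      moreover have "d \<in> pverts ?H \<rightarrow>\<^sub>E {..<k}"
        using c vw by (auto simp: d_def proper_colorings_iff contract_edge_def delete_edge_def PiE_iff extensional_def)
      ultimately have "d \<in> proper_colorings ?H k" unfolding proper_colorings_iff by simp
      then show "d \<in> ?S" using vw by (simp add: d_def)
    qed
  qed
  ultimately show ?thesis by (simp add: bij_betw_same_card)
qed

lemma chromatic_poly_delete_contract:
  assumes "pair_graph G" "(v, w) \<in> parcs G"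
  shows "chromatic_poly G = chromatic_poly (delete_edge G v w) - chromatic_poly (contract_edge G v w)"
  using assms
  by (intro chromatic_poly_eqI)
     (auto simp: poly_chromatic_poly pair_graph_delete_edge pair_graph_contract_edge card_proper_colorings_delete_contract)

lemma card_proper_colorings_simplicial_vertex:
  assumes G: "pair_graph G" and w: "w \<in> pverts G"
    and clique: "\<And>i j. (w, i) \<in> parcs G \<Longrightarrow> (w, j) \<in> parcs G \<Longrightarrow> i \<noteq> j \<Longrightarrow> (i, j) \<in> parcs G"
  shows "real (card (proper_colorings G k))
       = (real k - real (card (parcs G `` {w}))) * real (card (proper_colorings (delete_vertex G w) k))"
proof -
  let ?H = "delete_vertex G w" and ?N = "parcs G `` {w}"
  have wf: "i \<in> pverts G \<and> j \<in> pverts G \<and> i \<noteq> j" if "(i, j) \<in> parcs G" for i j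
    using G that by (auto simp: pair_graph_iff irrefl_def)
  have sy: "(i, j) \<in> parcs G \<Longrightarrow> (j, i) \<in> parcs G" for i j
    using G by (auto simp: pair_graph_iff sym_def)
  have finV: "finite (pverts G)" using G by (simp add: pair_graph_iff)
  have finN: "finite ?N" using finV wf by (auto intro: finite_subset[of _ "pverts G"])
  have finH: "finite (proper_colorings ?H k)"
    using finV by (auto intro!: finite_proper_colorings simp: delete_vertex_def)
  have "bij_betw (\<lambda>c. (c(w := undefined), c w)) (proper_colorings G k)
          (SIGMA c:proper_colorings ?H k. {..<k} - c ` ?N)"
  proof (rule bij_betw_byWitness[where f' = "\<lambda>(c, a). c(w := a)"])
    show "\<forall>c\<in>proper_colorings G k. (case (c(w := undefined), c w) of (c, a) \<Rightarrow> c(w := a)) = c"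
      by auto
    show "\<forall>x\<in>SIGMA c:proper_colorings ?H k. {..<k} - c ` ?N.
        (((case x of (c, a) \<Rightarrow> c(w := a))(w := undefined)), (case x of (c, a) \<Rightarrow> c(w := a)) w) = x"
      by (auto simp: proper_colorings_def delete_vertex_def PiE_def extensional_def)
    show "(\<lambda>c. (c(w := undefined), c w)) ` proper_colorings G k
        \<subseteq> (SIGMA c:proper_colorings ?H k. {..<k} - c ` ?N)"
    proof (rule image_subsetI)
      fix c assume c: "c \<in> proper_colorings G k"
      have c0: "c(w := undefined) \<in> proper_colorings ?H k"
        using c by (auto simp: proper_colorings_def delete_vertex_def PiE_iff extensional_def)
      have "c w \<noteq> (c(w := undefined)) x" if "x \<in> ?N" for x
        using c that wf[of w x] by (auto simp: proper_colorings_def)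
      moreover have "c w < k" using c w by (auto simp: proper_colorings_def PiE_iff)
      ultimately show "(c(w := undefined), c w) \<in> (SIGMA c:proper_colorings ?H k. {..<k} - c ` ?N)"
        using c0 by blast
    qed
    show "(\<lambda>(c, a). c(w := a)) ` (SIGMA c:proper_colorings ?H k. {..<k} - c ` ?N) \<subseteq> proper_colorings G k"
    proof (rule image_subsetI, clarify)
      fix c a assume c: "c \<in> proper_colorings ?H k" and a: "a < k" "a \<notin> c ` ?N"
      define d where "d = c(w := a)"
      have "d i \<noteq> d j" if ij: "(i, j) \<in> parcs G" for i j
      proof (cases "i = w \<or> j = w")
        case True
        then show ?thesis using a(2) sy[OF ij] wf[OF ij] ij by (auto simp: d_def)
      next
        case False
        then show ?thesis using c ij by (simp add: d_def proper_colorings_iff delete_vertex_def)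
      qed
      moreover have "d \<in> pverts G \<rightarrow>\<^sub>E {..<k}"
        using c w a(1) by (auto simp: d_def proper_colorings_iff delete_vertex_def PiE_iff extensional_def)
      ultimately show "d \<in> proper_colorings G k"
        unfolding proper_colorings_iff by blast
    qed
  qed
  then have "card (proper_colorings G k) = (\<Sum>c\<in>proper_colorings ?H k. card ({..<k} - c ` ?N))"
    using finH by (simp add: bij_betw_same_card)
  then have "real (card (proper_colorings G k)) = (\<Sum>c\<in>proper_colorings ?H k. real (card ({..<k} - c ` ?N)))"
    by simp
  also have "\<dots> = (\<Sum>c\<in>proper_colorings ?H k. real k - real (card ?N))"
  proof (rule sum.cong[OF refl])
    fix c assume c: "c \<in> proper_colorings ?H k"
    have "inj_on c ?N"
    proof (rule inj_onI, rule ccontr)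
      fix i j assume ij: "i \<in> ?N" "j \<in> ?N" "c i = c j" "i \<noteq> j"
      then have "(i, j) \<in> parcs ?H" using clique wf[of w i] wf[of w j] by (auto simp: delete_vertex_def)
      then show False using c ij(3) by (auto simp: proper_colorings_def)
    qed
    then have card: "card (c ` ?N) = card ?N" by (rule card_image)
    have sub: "c ` ?N \<subseteq> {..<k}"
    proof (rule image_subsetI)
      fix x assume "x \<in> ?N"
      then have "x \<in> pverts ?H" using wf[of w x] by (auto simp: delete_vertex_def)
      then show "c x \<in> {..<k}" using c by (auto simp: proper_colorings_def PiE_iff)
    qed
    \<comment> \<open>The mere existence of \<open>c\<close> bounds the degree of \<open>w\<close>
      by \<open>k\<close>, so the subtraction of natural numbers is not truncated.\<close>
    then have "card (c ` ?N) \<le> k" using card_mono[OF _ sub] by simp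
    with sub card show "real (card ({..<k} - c ` ?N)) = real k - real (card ?N)"
      using finN by (simp add: card_Diff_subset of_nat_diff)
  qed
  finally show ?thesis by simp
qed

text \<open>Applied to the vertices of complete graphs, to isolated vertices (factor
  \<open>[:0, 1:]\<close>) and to leaves (factor \<open>[:-1, 1:]\<close>).\<close>

lemma chromatic_poly_simplicial_vertex:
  assumes "pair_graph G" "w \<in> pverts G"
    and "\<And>i j. (w, i) \<in> parcs G \<Longrightarrow> (w, j) \<in> parcs G \<Longrightarrow> i \<noteq> j \<Longrightarrow> (i, j) \<in> parcs G"
  shows "chromatic_poly G = [:- real (card (parcs G `` {w})), 1:] * chromatic_poly (delete_vertex G w)"
  using card_proper_colorings_simplicial_vertex[OF assms] assms(1)
  by (intro chromatic_poly_eqI) (auto simp: poly_chromatic_poly pair_graph_delete_vertex algebra_simps)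

text \<open>Every vertex of a complete graph is simplicial, so the vertices can be removed one at a
  time; the result is the falling factorial.\<close>

lemma chromatic_poly_complete:
  assumes "finite V"
  shows "chromatic_poly \<lparr> pverts = V, parcs = {(i, j). i \<in> V \<and> j \<in> V \<and> i \<noteq> j} \<rparr> = (\<Prod>i<card V. [:- real i, 1:])"
  using assms
proof (induction V rule: finite_induct)
  case empty
  show ?case
    by (rule chromatic_poly_eqI) (auto simp: pair_graph_iff sym_def irrefl_def proper_colorings_def)
next
  case (insert w V)
  let ?K = "\<lambda>V. \<lparr> pverts = V, parcs = {(i, j). i \<in> V \<and> j \<in> V \<and> i \<noteq> j} \<rparr>"
  have g: "pair_graph (?K (insert w V))"
    using insert.hyps by (auto simp: pair_graph_iff sym_def irrefl_def)
  have "delete_vertex (?K (insert w V)) w = ?K V"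
    using insert.hyps by (auto simp: delete_vertex_def)
  moreover have "parcs (?K (insert w V)) `` {w} = V" using insert.hyps by auto
  ultimately show ?case
    using chromatic_poly_simplicial_vertex[OF g, of w] insert by (simp add: mult.commute)
qed

subsection \<open>Deletion and contraction for acyclic orientations\<close>

text \<open>One family for all counts: empty \<open>B\<close> and \<open>S\<close> give all acyclic
  orientations, and \<open>S\<close> is empty or the complement of \<open>B\<close> for the two
  kinds of orientations in the theorem. The order condition only concerns single arcs. If
  \<open>B\<close> is a clique and \<open>u\<close> is injective on it, it fixes the orientation on
  \<open>B\<close>, and acyclicity then forces it along paths.\<close>

definition ordered_orientations ::
  "'a pair_pre_digraph \<Rightarrow> 'a set \<Rightarrow> ('a \<Rightarrow> real) \<Rightarrow> 'a set \<Rightarrow> 'a rel set" where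
  "ordered_orientations G B u S =
     {D \<in> acyclic_orientations G. (\<forall>i \<in> B. \<forall>j \<in> B. (i, j) \<in> D \<longrightarrow> u j < u i) \<and>
        (\<forall>x \<in> S. \<not> is_sink D x \<and> \<not> is_source D x)}"

lemma finite_ordered_orientations: "pair_graph G \<Longrightarrow> finite (ordered_orientations G B u S)"
  by (rule finite_subset[of _ "Pow (parcs G)"])
     (auto simp: ordered_orientations_def acyclic_orientations_def orientations_def pair_graph_iff
           intro: finite_subset)

lemma orientationsI:
  assumes "D \<subseteq> parcs G"
    and "\<And>i j. (i, j) \<in> parcs G \<Longrightarrow> (i, j) \<notin> D \<Longrightarrow> (j, i) \<in> D"
    and "\<And>i j. (i, j) \<in> D \<Longrightarrow> (j, i) \<notin> D"
  shows "D \<in> orientations G"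
  using assms unfolding orientations_def by blast

lemma
  assumes "D \<in> orientations G"
  shows orientations_parcs: "(i, j) \<in> D \<Longrightarrow> (i, j) \<in> parcs G"
    and orientations_total: "(i, j) \<in> parcs G \<Longrightarrow> (i, j) \<notin> D \<Longrightarrow> (j, i) \<in> D"
    and orientations_asym: "(i, j) \<in> D \<Longrightarrow> (j, i) \<notin> D"
  using assms unfolding orientations_def by blast+

lemma ordered_orientations_iff:
  "D \<in> ordered_orientations G B u S \<longleftrightarrow>
     D \<in> orientations G \<and> acyclic D \<and> (\<forall>i\<in>B. \<forall>j\<in>B. (i, j) \<in> D \<longrightarrow> u j < u i) \<and>
     (\<forall>x\<in>S. \<not> is_sink D x \<and> \<not> is_source D x)"
  by (auto simp: ordered_orientations_def acyclic_orientations_def)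

lemma acyclicD: "acyclic D \<Longrightarrow> (i, i) \<notin> D\<^sup>+"
  by (simp add: acyclic_def)

section \<open>Directed paths and cycles after merging two vertices\<close>

lemma trancl_map_prod: "(i, j) \<in> D\<^sup>+ \<Longrightarrow> (f i, f j) \<in> (map_prod f f ` D)\<^sup>+"
proof (induction rule: trancl_induct)
  case (base y)
  then have "(f i, f y) \<in> map_prod f f ` D" by (rule map_prod_imageI)
  then show ?case by (rule r_into_trancl)
next
  case (step y z)
  from step.hyps(2) have "(f y, f z) \<in> map_prod f f ` D" by (rule map_prod_imageI)
  with step.IH show ?case by (rule trancl_into_trancl)
qed

text \<open>A path in the merged relation lifts to a path of \<open>D\<close>, except that at the
  merged vertex the lift may jump between \<open>v\<close> and \<open>w\<close>. Between two jumps
  there would be a nonempty path of \<open>D\<close> with both ends in \<open>{v, w}\<close>, which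
  the hypotheses exclude; so one jump suffices.\<close>

lemma trancl_merge_cases:
  assumes ac: "acyclic D" and no: "(v, w) \<notin> D\<^sup>+" "(w, v) \<notin> D\<^sup>+"
    and path: "(a, b) \<in> (map_prod (merge v w) (merge v w) ` D)\<^sup>+"
  obtains (direct) i j where "merge v w i = a" "merge v w j = b" "(i, j) \<in> D\<^sup>+"
  | (via) i x y j where "merge v w i = a" "(i, x) \<in> D\<^sup>+" "x \<in> {v, w}"
      "y \<in> {v, w}" "(y, j) \<in> D\<^sup>+" "merge v w j = b"
proof -
  let ?f = "merge v w"
  have f_eq: "x = y \<or> x \<in> {v, w} \<and> y \<in> {v, w}" if "?f x = ?f y" for x y
    using that by (auto simp: merge_def split: if_splits)
  have no': "(x, y) \<notin> D\<^sup>+" if "x \<in> {v, w}" "y \<in> {v, w}" for x y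
    using that no acyclicD[OF ac] by auto
  have "(\<exists>i j. ?f i = a \<and> ?f j = b \<and> (i, j) \<in> D\<^sup>+) \<or>
    (\<exists>i x y j. ?f i = a \<and> (i, x) \<in> D\<^sup>+ \<and> x \<in> {v, w} \<and> y \<in> {v, w} \<and> (y, j) \<in> D\<^sup>+ \<and> ?f j = b)"
    using path
  proof (induction rule: trancl_induct)
    case (base b)
    then show ?case by blast
  next
    case (step b c)
    from step.hyps(2) obtain k l where kl: "(k, l) \<in> D" "b = ?f k" "c = ?f l" by auto
    from step.IH show ?case
    proof (elim disjE exE conjE)
      fix i j assume a: "?f i = a" "?f j = b" "(i, j) \<in> D\<^sup>+"
      with f_eq[of j k] kl(2) consider "j = k" | "j \<in> {v, w}" "k \<in> {v, w}" by auto
      then show ?thesis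
      proof cases
        case 1
        with a kl have "(i, l) \<in> D\<^sup>+" by auto
        with a kl show ?thesis by blast
      next
        case 2
        with a kl show ?thesis by blast
      qed
    next
      fix i x y j assume a: "?f i = a" "(i, x) \<in> D\<^sup>+" "x \<in> {v, w}" "y \<in> {v, w}" "(y, j) \<in> D\<^sup>+" "?f j = b"
      \<comment> \<open>A second jump would put \<open>j\<close> into \<open>{v, w}\<close> and make
        the path from \<open>y\<close> to \<open>j\<close> forbidden.\<close>
      with f_eq[of j k] kl(2) no'[of y j] have "j = k" by auto
      with a kl have "(y, l) \<in> D\<^sup>+" by auto
      with a kl show ?thesis by blast
    qed
  qed
  then show ?thesis using direct via by blast
qed

text \<open>A path between \<open>v\<close> and \<open>w\<close> becomes a cycle after merging.
  Conversely, a cycle of the merged relation lifts to a cycle of \<open>D\<close> or yields a path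
  of \<open>D\<close> with both ends in \<open>{v, w}\<close>.\<close>

lemma acyclic_merge_iff:
  assumes ac: "acyclic D"
  shows "acyclic (map_prod (merge v w) (merge v w) ` D) \<longleftrightarrow> (v, w) \<notin> D\<^sup>+ \<and> (w, v) \<notin> D\<^sup>+"
proof
  have f: "merge v w v = v" "merge v w w = v" by (auto simp: merge_def)
  assume "acyclic (map_prod (merge v w) (merge v w) ` D)"
  then show "(v, w) \<notin> D\<^sup>+ \<and> (w, v) \<notin> D\<^sup>+"
    using trancl_map_prod[of v w D "merge v w"] trancl_map_prod[of w v D "merge v w"]
    unfolding f by (auto dest: acyclicD)
next
  let ?f = "merge v w"
  assume no: "(v, w) \<notin> D\<^sup>+ \<and> (w, v) \<notin> D\<^sup>+"
  have f_eq: "x = y \<or> x \<in> {v, w} \<and> y \<in> {v, w}" if "?f x = ?f y" for x y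
    using that by (auto simp: merge_def split: if_splits)
  have no': "(x, y) \<notin> D\<^sup>+" if "x \<in> {v, w}" "y \<in> {v, w}" for x y
    using that no acyclicD[OF ac] by auto
  have "(a, a) \<notin> (map_prod ?f ?f ` D)\<^sup>+" for a
  proof
    assume "(a, a) \<in> (map_prod ?f ?f ` D)\<^sup>+"
    with ac conjunct1[OF no] conjunct2[OF no] show False
    proof (cases rule: trancl_merge_cases)
      case (direct i j)
      then show False using f_eq[of i j] no'[of i j] acyclicD[OF ac, of i] by auto
    next
      case (via i x y j)
      show False
      proof (cases "i = j")
        case True
        with via have "(y, x) \<in> D\<^sup>+" by auto
        with via no' show False by blast
      next
        case False
        with via f_eq[of i j] have "i \<in> {v, w}" by auto
        with via no' show False by blast
      qed
    qed
  qed
  then show "acyclic (map_prod ?f ?f ` D)" by (simp add: acyclic_def)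
qed

section \<open>Transfer of orientations between a graph, its deletion and its contraction\<close>

lemma orientations_insertI:
  assumes G: "pair_graph G" and e: "(v, w) \<in> parcs G" and D: "D \<in> orientations (delete_edge G v w)"
  shows "insert (v, w) D \<in> orientations G"
proof -
  have "v \<noteq> w" "(w, v) \<in> parcs G" using G e by (auto simp: pair_graph_iff irrefl_def sym_def)
  have sub: "(i, j) \<in> parcs G \<and> (i, j) \<noteq> (v, w) \<and> (i, j) \<noteq> (w, v)" if "(i, j) \<in> D" for i j
    using orientations_parcs[OF D that] by (simp add: parcs_delete_edge_iff)
  show ?thesis
  proof (rule orientationsI)
    show "insert (v, w) D \<subseteq> parcs G" using e sub by auto
    show "(j, i) \<in> insert (v, w) D" if "(i, j) \<in> parcs G" "(i, j) \<notin> insert (v, w) D" for i j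
      using that orientations_total[OF D, of i j] by (auto simp: parcs_delete_edge_iff)
    show "(j, i) \<notin> insert (v, w) D" if "(i, j) \<in> insert (v, w) D" for i j
      using that sub[of j i] sub[of i j] orientations_asym[OF D, of i j] \<open>v \<noteq> w\<close> by blast
  qed
qed

text \<open>Acyclicity of the image excludes that a common neighbor of \<open>v\<close> and
  \<open>w\<close> is joined to the merged vertex in both directions.\<close>

lemma orientations_mergeI:
  assumes D: "D \<in> orientations (delete_edge G v w)"
    and ac: "acyclic (map_prod (merge v w) (merge v w) ` D)" (is "acyclic ?D")
  shows "?D \<in> orientations (contract_edge G v w)"
proof (rule orientationsI)
  show "?D \<subseteq> parcs (contract_edge G v w)"
    unfolding parcs_contract_edge using orientations_parcs[OF D] by (intro image_mono) auto
  show "(b, a) \<notin> ?D" if "(a, b) \<in> ?D" for a b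
    using that acyclicD[OF ac, of a] by (meson r_into_trancl trancl_into_trancl)
  fix a b assume ab: "(a, b) \<in> parcs (contract_edge G v w)" "(a, b) \<notin> ?D"
  from ab(1) obtain i j where ij: "(i, j) \<in> parcs (delete_edge G v w)" "a = merge v w i" "b = merge v w j"
    by (rule parcs_contract_edgeE)
  then have "(i, j) \<notin> D" using ab(2) map_prod_imageI[of i j D "merge v w" "merge v w"] by auto
  with ij(1) have "(j, i) \<in> D" by (rule orientations_total[OF D])
  then show "(b, a) \<in> ?D" unfolding ij(2,3) by (rule map_prod_imageI)
qed

text \<open>Removing the arc may create sinks and sources. Hence the deletion carries the empty set
  in place of \<open>S\<close>, and the condition on \<open>S\<close> is imposed on the completed
  orientation.\<close>

lemma card_insert_orientations:
  assumes G: "pair_graph G" and e: "(v, w) \<in> parcs G" and w: "w \<notin> B \<or> v \<notin> B"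
  shows "card {D \<in> ordered_orientations G B u S. (v, w) \<in> D}
       = card {D \<in> ordered_orientations (delete_edge G v w) B u {}. insert (v, w) D \<in> ordered_orientations G B u S}"
proof (rule bij_betw_same_card[of "\<lambda>D. D - {(v, w)}"], rule bij_betw_byWitness[where f' = "insert (v, w)"])
  let ?H = "delete_edge G v w"
  let ?X = "{D \<in> ordered_orientations ?H B u {}. insert (v, w) D \<in> ordered_orientations G B u S}"
  have vw: "v \<noteq> w" "(w, v) \<in> parcs G" using G e by (auto simp: pair_graph_iff irrefl_def sym_def)
  show "\<forall>D\<in>{D \<in> ordered_orientations G B u S. (v, w) \<in> D}. insert (v, w) (D - {(v, w)}) = D" by auto
  show "\<forall>D\<in>?X. insert (v, w) D - {(v, w)} = D"
    by (auto simp: ordered_orientations_iff parcs_delete_edge_iff dest: orientations_parcs)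
  show "insert (v, w) ` ?X \<subseteq> {D \<in> ordered_orientations G B u S. (v, w) \<in> D}" by auto
  show "(\<lambda>D. D - {(v, w)}) ` {D \<in> ordered_orientations G B u S. (v, w) \<in> D} \<subseteq> ?X"
  proof (rule image_subsetI)
    fix D assume "D \<in> {D \<in> ordered_orientations G B u S. (v, w) \<in> D}"
    then have D: "D \<in> ordered_orientations G B u S" "(v, w) \<in> D" by auto
    have o: "D \<in> orientations G" using D by (simp add: ordered_orientations_iff)
    have "D - {(v, w)} \<in> orientations ?H"
    proof (rule orientationsI)
      show "D - {(v, w)} \<subseteq> parcs ?H"
        using orientations_parcs[OF o] orientations_asym[OF o D(2)] by (auto simp: parcs_delete_edge_iff)
      show "(j, i) \<in> D - {(v, w)}" if "(i, j) \<in> parcs ?H" "(i, j) \<notin> D - {(v, w)}" for i j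
        using that orientations_total[OF o, of i j] by (auto simp: parcs_delete_edge_iff)
      show "(j, i) \<notin> D - {(v, w)}" if "(i, j) \<in> D - {(v, w)}" for i j
        using that orientations_asym[OF o, of i j] by blast
    qed
    moreover have "acyclic (D - {(v, w)})"
      using D(1) by (auto simp: ordered_orientations_iff intro: acyclic_subset)
    ultimately have "D - {(v, w)} \<in> ordered_orientations ?H B u {}"
      using D(1) by (simp add: ordered_orientations_iff)
    moreover have "insert (v, w) (D - {(v, w)}) = D" using D by auto
    ultimately show "D - {(v, w)} \<in> ?X" using D(1) by simp
  qed
qed

text \<open>An orientation of the contraction has exactly one preimage, in which every edge is
  directed like its image; a cycle in the preimage would map to a cycle. Elements of
  \<open>B\<close> are fixed by \<open>merge v w\<close> because \<open>w\<close> lies outside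
  \<open>B\<close>, so the order condition carries over to the preimage.\<close>

lemma card_contract_orientations:
  assumes G: "pair_graph G" and B: "w \<notin> B"
  shows "card {D \<in> ordered_orientations (delete_edge G v w) B u {}.
           map_prod (merge v w) (merge v w) ` D \<in> ordered_orientations (contract_edge G v w) B u S}
       = card (ordered_orientations (contract_edge G v w) B u S)" (is "card ?Z = card ?Y")
proof (rule bij_betw_same_card, rule bij_betw_imageI)
  let ?H = "delete_edge G v w" and ?f = "merge v w" and ?K = "contract_edge G v w"
  show "inj_on (\<lambda>D. map_prod ?f ?f ` D) ?Z"
  proof (rule inj_on_inverseI[where g = "\<lambda>D'. {(i, j) \<in> parcs ?H. (?f i, ?f j) \<in> D'}"])
    fix D assume D: "D \<in> ?Z"
    then have o: "D \<in> orientations ?H" "map_prod ?f ?f ` D \<in> orientations ?K"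
      by (auto simp: ordered_orientations_iff)
    have "(i, j) \<in> D" if "(i, j) \<in> parcs ?H" "(?f i, ?f j) \<in> map_prod ?f ?f ` D" for i j
    proof (rule ccontr)
      assume "(i, j) \<notin> D"
      with that(1) have "(j, i) \<in> D" by (rule orientations_total[OF o(1)])
      then have "(?f j, ?f i) \<in> map_prod ?f ?f ` D" by (rule map_prod_imageI)
      with orientations_asym[OF o(2) that(2)] show False by (rule notE)
    qed
    moreover have "(i, j) \<in> parcs ?H \<and> (?f i, ?f j) \<in> map_prod ?f ?f ` D" if "(i, j) \<in> D" for i j
      using orientations_parcs[OF o(1) that] map_prod_imageI[OF that, of ?f ?f] by simp
    ultimately show "{(i, j) \<in> parcs ?H. (?f i, ?f j) \<in> map_prod ?f ?f ` D} = D"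
      by (intro equalityI subrelI) simp_all
  qed
  show "(\<lambda>D. map_prod ?f ?f ` D) ` ?Z = ?Y"
  proof
    show "(\<lambda>D. map_prod ?f ?f ` D) ` ?Z \<subseteq> ?Y" by blast
    show "?Y \<subseteq> (\<lambda>D. map_prod ?f ?f ` D) ` ?Z"
    proof
      fix D' assume D': "D' \<in> ?Y"
      then have o: "D' \<in> orientations ?K" "acyclic D'"
        by (auto simp: ordered_orientations_iff)
      define D where "D = {(i, j) \<in> parcs ?H. (?f i, ?f j) \<in> D'}"
      have sub: "map_prod ?f ?f ` D \<subseteq> D'" by (auto simp: D_def)
      have "D' \<subseteq> map_prod ?f ?f ` D"
      proof (rule subrelI)
        fix a b assume ab: "(a, b) \<in> D'"
        then have "(a, b) \<in> parcs ?K" by (rule orientations_parcs[OF o(1)])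
        then obtain i j where ij: "(i, j) \<in> parcs ?H" "a = ?f i" "b = ?f j"
          by (rule parcs_contract_edgeE)
        then have "(i, j) \<in> D" using ab by (simp add: D_def)
        then show "(a, b) \<in> map_prod ?f ?f ` D" unfolding ij(2,3) by (rule map_prod_imageI)
      qed
      with sub have fD: "map_prod ?f ?f ` D = D'" by (rule equalityI)
      have sym: "(i, j) \<in> parcs ?H \<Longrightarrow> (j, i) \<in> parcs ?H" for i j
        using pair_graph_delete_edge[OF G] by (auto simp: pair_graph_iff sym_def)
      have "D \<in> orientations ?H"
      proof (rule orientationsI)
        show "D \<subseteq> parcs ?H" by (auto simp: D_def)
        show "(j, i) \<notin> D" if "(i, j) \<in> D" for i j
          using that orientations_asym[OF o(1), of "?f i" "?f j"] by (simp add: D_def)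
        show "(j, i) \<in> D" if "(i, j) \<in> parcs ?H" "(i, j) \<notin> D" for i j
          using that sym[OF that(1)] orientations_total[OF o(1) parcs_contract_edgeI[OF that(1)]]
          by (simp add: D_def)
      qed
      moreover have "acyclic D"
        unfolding acyclic_def using trancl_map_prod[of _ _ D ?f, unfolded fD] acyclicD[OF o(2)] by blast
      moreover have "u j < u i" if "i \<in> B" "j \<in> B" "(i, j) \<in> D" for i j
      proof -
        have "?f i = i" "?f j = j" using that B by (auto simp: merge_def)
        then have "(i, j) \<in> D'" using that by (simp add: D_def)
        then show ?thesis using D' that by (simp add: ordered_orientations_iff)
      qed
      ultimately have "D \<in> ordered_orientations ?H B u {}"
        by (simp add: ordered_orientations_iff)
      with D' fD show "D' \<in> (\<lambda>D. map_prod ?f ?f ` D) ` ?Z" by blast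
    qed
  qed
qed

section \<open>Sinks and sources under deletion and contraction\<close>

lemma is_sink_insert: "is_sink (insert (v, w) D) x \<longleftrightarrow> x \<noteq> v \<and> is_sink D x"
  by (auto simp: is_sink_def)

lemma is_source_insert: "is_source (insert (v, w) D) x \<longleftrightarrow> x \<noteq> w \<and> is_source D x"
  by (auto simp: is_source_def)

text \<open>The fibre of \<open>v\<close> is \<open>{v, w}\<close>, so the merged vertex is a sink
  only if both ends were. For distinct \<open>v\<close> and \<open>w\<close> the fibre of
  \<open>w\<close> is empty, which makes \<open>w\<close> vacuously a sink; this is why
  \<open>w\<close> is taken out of \<open>S\<close> on contraction.\<close>

lemma is_sink_merge:
  "is_sink (map_prod (merge v w) (merge v w) ` D) x \<longleftrightarrow> (\<forall>y. merge v w y = x \<longrightarrow> is_sink D y)"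
proof -
  have "(\<exists>z. (x, z) \<in> map_prod (merge v w) (merge v w) ` D) \<longleftrightarrow> (\<exists>y z. merge v w y = x \<and> (y, z) \<in> D)"
    by (auto intro: map_prod_imageI)
  then show ?thesis unfolding is_sink_def by blast
qed

lemma is_source_merge:
  "is_source (map_prod (merge v w) (merge v w) ` D) x \<longleftrightarrow> (\<forall>y. merge v w y = x \<longrightarrow> is_source D y)"
proof -
  have "(\<exists>z. (z, x) \<in> map_prod (merge v w) (merge v w) ` D) \<longleftrightarrow> (\<exists>y z. merge v w y = x \<and> (z, y) \<in> D)"
    by (auto intro: map_prod_imageI)
  then show ?thesis unfolding is_source_def by blast
qed

text \<open>
  Every acyclic orientation of the graph without the edge \<open>e\<close> extends to \<open>e\<close> in one or two ways, and in two
  ways exactly if it induces an acyclic orientation of the contraction.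
\<close>

lemma card_ordered_orientations_delete_contract:
  assumes G: "pair_graph G" and e: "(v, w) \<in> parcs G" and w: "w \<notin> B"
    and clique: "\<And>i j. i \<in> B \<Longrightarrow> j \<in> B \<Longrightarrow> i \<noteq> j \<Longrightarrow> (i, j) \<in> parcs G"
    and SB: "S \<inter> B = {}" and S: "v \<in> B \<or> (v \<in> S \<longleftrightarrow> w \<in> S)"
    and noniso: "\<And>x. x \<in> S \<Longrightarrow> x = v \<or> x = w \<Longrightarrow> \<exists>y. (x, y) \<in> parcs (delete_edge G v w)"
  shows "card (ordered_orientations G B u S)
       = card (ordered_orientations (delete_edge G v w) B u S)
       + card (ordered_orientations (contract_edge G v w) B u (S - {w}))"
proof -
  let ?H = "delete_edge G v w" and ?K = "contract_edge G v w"
  let ?m = "\<lambda>D. map_prod (merge v w) (merge v w) ` D"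
  let ?A = "ordered_orientations ?H B u {}"
  let ?X1 = "{D \<in> ?A. insert (v, w) D \<in> ordered_orientations G B u S}"
  let ?X2 = "{D \<in> ?A. insert (w, v) D \<in> ordered_orientations G B u S}"
  let ?Y = "{D \<in> ?A. D \<in> ordered_orientations ?H B u S}"
  let ?Z = "{D \<in> ?A. ?m D \<in> ordered_orientations ?K B u (S - {w})}"
  have vw: "v \<noteq> w" "(w, v) \<in> parcs G" using G e by (auto simp: pair_graph_iff irrefl_def sym_def)
  have swap: "delete_edge G w v = ?H" by (auto simp: delete_edge_def)
  have finA: "finite ?A" by (rule finite_ordered_orientations[OF pair_graph_delete_edge[OF G]])
  \<comment> \<open>\<open>?X1\<close> and \<open>?X2\<close> record the two directions in which the
    edge can be added, \<open>?Y\<close> and \<open>?Z\<close> the admissibility for deletion and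
    contraction. Each \<open>D\<close> lies in equally many sets of either pair, so the pairs have
    the same total size.\<close>
  have key: "(D \<in> ?X1 \<or> D \<in> ?X2 \<longleftrightarrow> D \<in> ?Y \<or> D \<in> ?Z) \<and> (D \<in> ?X1 \<and> D \<in> ?X2 \<longleftrightarrow> D \<in> ?Y \<and> D \<in> ?Z)"
    if D: "D \<in> ?A" for D
  proof -
    let ?ok = "\<lambda>D x. \<not> is_sink D x \<and> \<not> is_source D x"
    have o: "D \<in> orientations ?H" "acyclic D" and ord: "\<forall>i\<in>B. \<forall>j\<in>B. (i, j) \<in> D \<longrightarrow> u j < u i"
      using D by (auto simp: ordered_orientations_iff)
    have no_loop: "(x, x) \<notin> D\<^sup>+" for x using acyclicD[OF o(2)] .
    have asym: "\<not> ((v, w) \<in> D\<^sup>+ \<and> (w, v) \<in> D\<^sup>+)" using no_loop by (meson trancl_trans)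
    have X1: "D \<in> ?X1 \<longleftrightarrow> (w, v) \<notin> D\<^sup>+ \<and> (\<forall>x\<in>S. ?ok (insert (v, w) D) x)"
      using orientations_insertI[OF G e o(1)] D o(2) ord w vw
      by (auto simp: ordered_orientations_iff rtrancl_eq_or_trancl)
    have X2: "D \<in> ?X2 \<longleftrightarrow> (v, w) \<notin> D\<^sup>+ \<and> (\<forall>x\<in>S. ?ok (insert (w, v) D) x)"
      using orientations_insertI[OF G vw(2), unfolded swap, OF o(1)] D o(2) ord w vw
      by (auto simp: ordered_orientations_iff rtrancl_eq_or_trancl)
    have Y: "D \<in> ?Y \<longleftrightarrow> (\<forall>x\<in>S. ?ok D x)"
      using D by (auto simp: ordered_orientations_iff)
    \<comment> \<open>If \<open>v\<close> is in \<open>B\<close>, an arc of the image inside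
      \<open>B\<close> may stem from an arc at \<open>w\<close>. The clique supplies an edge of the
      deletion with the same ends, and acyclicity forces it to point the same way.\<close>
    have ordK: "\<forall>i\<in>B. \<forall>j\<in>B. (i, j) \<in> ?m D \<longrightarrow> u j < u i" if ac: "acyclic (?m D)"
    proof (intro ballI impI)
      fix i j assume ij: "i \<in> B" "j \<in> B" "(i, j) \<in> ?m D"
      have "i \<noteq> j" using r_into_trancl[OF ij(3)] acyclicD[OF ac, of i] by metis
      then have "(i, j) \<in> parcs ?H"
        using ij clique w by (auto simp: parcs_delete_edge_iff)
      moreover have "(j, i) \<notin> D"
      proof
        assume "(j, i) \<in> D"
        from map_prod_imageI[OF this, of "merge v w" "merge v w"] have "(j, i) \<in> ?m D"
          using ij w by (auto simp: merge_def split: if_splits)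
        with ij(3) show False using acyclicD[OF ac, of i] by (meson r_into_trancl trancl_into_trancl)
      qed
      ultimately have "(i, j) \<in> D" using orientations_total[OF o(1)] by blast
      then show "u j < u i" using ord ij by blast
    qed
    have Z: "D \<in> ?Z \<longleftrightarrow> (v, w) \<notin> D\<^sup>+ \<and> (w, v) \<notin> D\<^sup>+ \<and> (\<forall>x\<in>S - {w}. ?ok (?m D) x)"
      using D orientations_mergeI[OF o(1)] ordK acyclic_merge_iff[OF o(2), of v w]
      by (auto simp: ordered_orientations_iff)
    have okm: "?ok (?m D) x \<longleftrightarrow> ?ok D x" if "x \<noteq> v" "x \<noteq> w" for x
      using that by (auto simp: is_sink_merge is_source_merge merge_def)
    have okv: "?ok (?m D) v \<longleftrightarrow> \<not> (is_sink D v \<and> is_sink D w) \<and> \<not> (is_source D v \<and> is_source D w)"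
      by (auto simp: is_sink_merge is_source_merge merge_def)
    have okins: "?ok (insert (v, w) D) x \<longleftrightarrow> ?ok D x" "?ok (insert (w, v) D) x \<longleftrightarrow> ?ok D x"
      if "x \<noteq> v" "x \<noteq> w" for x
      using that by (auto simp: is_sink_insert is_source_insert)
    \<comment> \<open>Only an isolated vertex is both a sink and a source, and \<open>noniso\<close>
      gives \<open>x\<close> an edge other than the deleted one.\<close>
    have iso: "\<not> (is_sink D x \<and> is_source D x)" if "x \<in> S" "x = v \<or> x = w" for x
      using noniso[OF that] orientations_total[OF o(1)] by (auto simp: is_sink_def is_source_def)
    have sink: "is_sink D x \<Longrightarrow> (x, y) \<notin> D\<^sup>+" for x y
      by (auto simp: is_sink_def dest: tranclD)
    have source: "is_source D x \<Longrightarrow> (y, x) \<notin> D\<^sup>+" for x y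
      by (auto simp: is_source_def dest: tranclD2)
    \<comment> \<open>The conditions away from \<open>v\<close> and \<open>w\<close> are common to
      all four sets. What remains is propositional: sinks and sources at \<open>v\<close> and
      \<open>w\<close>, and paths between them.\<close>
    let ?R = "\<forall>x\<in>S - {v, w}. ?ok D x"
    have X1': "D \<in> ?X1 \<longleftrightarrow> (w, v) \<notin> D\<^sup>+ \<and> ?R \<and> (v \<in> S \<longrightarrow> \<not> is_source D v) \<and> (w \<in> S \<longrightarrow> \<not> is_sink D w)"
      unfolding X1 using okins vw(1) by (auto simp: is_sink_insert is_source_insert)
    have X2': "D \<in> ?X2 \<longleftrightarrow> (v, w) \<notin> D\<^sup>+ \<and> ?R \<and> (v \<in> S \<longrightarrow> \<not> is_sink D v) \<and> (w \<in> S \<longrightarrow> \<not> is_source D w)"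
      unfolding X2 using okins vw(1) by (auto simp: is_sink_insert is_source_insert)
    have Y': "D \<in> ?Y \<longleftrightarrow> ?R \<and> (v \<in> S \<longrightarrow> ?ok D v) \<and> (w \<in> S \<longrightarrow> ?ok D w)"
      unfolding Y by auto
    have "(\<forall>x\<in>S - {w}. ?ok (?m D) x) \<longleftrightarrow> (\<forall>x\<in>S - {v, w}. ?ok (?m D) x) \<and> (v \<in> S \<longrightarrow> ?ok (?m D) v)"
      using vw(1) by blast
    also have "(\<forall>x\<in>S - {v, w}. ?ok (?m D) x) \<longleftrightarrow> ?R"
      by (rule ball_cong[OF refl]) (use okm in simp)
    finally have Z': "D \<in> ?Z \<longleftrightarrow> (v, w) \<notin> D\<^sup>+ \<and> (w, v) \<notin> D\<^sup>+ \<and> ?R \<and>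
        (v \<in> S \<longrightarrow> \<not> (is_sink D v \<and> is_sink D w) \<and> \<not> (is_source D v \<and> is_source D w))"
      unfolding Z okv by simp
    \<comment> \<open>If \<open>v\<close> is in \<open>B\<close>, so is the merged vertex, and it
      carries no sink or source condition; otherwise \<open>v\<close> and \<open>w\<close> carry the
      condition together or not at all.\<close>
    have vS: "v \<notin> B \<Longrightarrow> v \<in> S \<longleftrightarrow> w \<in> S" "v \<in> B \<Longrightarrow> v \<notin> S" using S SB by auto
    show ?thesis
      unfolding X1' X2' Y' Z'
      using vS iso[of v] iso[of w] asym sink[of v w] sink[of w v] source[of v w] source[of w v]
      by argo
  qed
  have X: "card (ordered_orientations G B u S) = card ?X1 + card ?X2"
  proof -
    let ?P = "\<lambda>e. {D \<in> ordered_orientations G B u S. e \<in> D}"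
    have "(v, w) \<in> D \<longleftrightarrow> (w, v) \<notin> D" if "D \<in> ordered_orientations G B u S" for D
    proof -
      have o: "D \<in> orientations G" using that by (simp add: ordered_orientations_iff)
      show ?thesis using orientations_total[OF o e] orientations_asym[OF o, of v w] by blast
    qed
    then have un: "?P (v, w) \<union> ?P (w, v) = ordered_orientations G B u S" and "?P (v, w) \<inter> ?P (w, v) = {}"
      by blast+
    then have "card (?P (v, w) \<union> ?P (w, v)) = card (?P (v, w)) + card (?P (w, v))"
      using finite_ordered_orientations[OF G, of B u S] by (intro card_Un_disjoint) simp_all
    then show ?thesis
      using card_insert_orientations[OF G e, of B u S] card_insert_orientations[OF G vw(2), of B u S] w
      unfolding un swap by simp
  qed
  have "?X1 \<union> ?X2 = ?Y \<union> ?Z" "?X1 \<inter> ?X2 = ?Y \<inter> ?Z"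
    using key by (auto simp del: mem_Collect_eq)
  then have "card ?X1 + card ?X2 = card ?Y + card ?Z"
    using card_Un_Int[of ?X1 ?X2] card_Un_Int[of ?Y ?Z] finA by simp
  moreover have "?Y = ordered_orientations ?H B u S"
    by (auto simp: ordered_orientations_iff)
  moreover have "card ?Z = card (ordered_orientations ?K B u (S - {w}))"
    by (rule card_contract_orientations[OF G w])
  ultimately show ?thesis using X by simp
qed

subsection \<open>Evaluating the chromatic polynomial\<close>

lemma pair_pre_digraph_eqI: "pverts G = pverts H \<Longrightarrow> parcs G = parcs H \<Longrightarrow> G = (H :: 'a pair_pre_digraph)"
  by simp

lemma acyclic_decreasing: "acyclic {(i, j). i \<in> B \<and> j \<in> B \<and> u j < (u i :: real)}" (is "acyclic ?T")
proof -
  have "u j < u i" if "(i, j) \<in> ?T\<^sup>+" for i j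
    using that by (induction rule: trancl_induct) auto
  then show ?thesis unfolding acyclic_def by blast
qed

text \<open>Injectivity of \<open>u\<close> leaves exactly one direction for every edge, and
  \<open>u\<close> strictly decreases along the resulting paths, so no cycle arises.\<close>

lemma ordered_orientations_complete:
  assumes E: "parcs G = {(i, j). i \<in> B \<and> j \<in> B \<and> i \<noteq> j}" and u: "inj_on u B"
  shows "ordered_orientations G B u {} = {{(i, j). i \<in> B \<and> j \<in> B \<and> u j < u i}}" (is "_ = {?T}")
proof (rule equalityI)
  have "?T \<in> orientations G"
  proof (rule orientationsI)
    show "?T \<subseteq> parcs G" unfolding E by auto
    show "(j, i) \<in> ?T" if "(i, j) \<in> parcs G" "(i, j) \<notin> ?T" for i j
    proof -
      have "i \<in> B" "j \<in> B" "i \<noteq> j" "\<not> u j < u i" using that unfolding E by auto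
      moreover from this have "u i \<noteq> u j" using u by (simp add: inj_on_eq_iff)
      ultimately show ?thesis by simp
    qed
    show "(j, i) \<notin> ?T" if "(i, j) \<in> ?T" for i j
      using that by auto
  qed
  then show "{?T} \<subseteq> ordered_orientations G B u {}"
    using acyclic_decreasing[of B u] by (simp add: ordered_orientations_iff)
  show "ordered_orientations G B u {} \<subseteq> {?T}"
  proof
    fix D assume D: "D \<in> ordered_orientations G B u {}"
    then have o: "D \<in> orientations G" and ord: "\<And>i j. i \<in> B \<Longrightarrow> j \<in> B \<Longrightarrow> (i, j) \<in> D \<Longrightarrow> u j < u i"
      by (auto simp: ordered_orientations_iff)
    have "(i, j) \<in> D \<longleftrightarrow> (i, j) \<in> ?T" for i j
    proof
      assume ij: "(i, j) \<in> D"
      then have "i \<in> B" "j \<in> B" using orientations_parcs[OF o ij] unfolding E by auto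
      then show "(i, j) \<in> ?T" using ord ij by simp
    next
      assume ij: "(i, j) \<in> ?T"
      then have e: "(i, j) \<in> parcs G" unfolding E by auto
      show "(i, j) \<in> D"
      proof (rule ccontr)
        assume "(i, j) \<notin> D"
        then have "(j, i) \<in> D" by (rule orientations_total[OF o e])
        then show False using ord[of j i] ij by auto
      qed
    qed
    then show "D \<in> {?T}" by auto
  qed
qed

text \<open>The factor with index \<open>i\<close> takes the value \<open>-(i + 1)\<close>.\<close>

lemma poly_falling_factorial_minus_one: "poly (\<Prod>i<m. [:- real i, 1:]) (-1) = (-1) ^ m * fact m"
  by (induction m) (simp_all add: algebra_simps)

text \<open>The factor with index 1 vanishes at 1, so only the summand of the product rule that
  differentiates it survives; the factors with indices 2 to \<open>k + 1\<close> take the values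
  \<open>-1\<close> to \<open>-k\<close>.\<close>

lemma poly_pderiv_falling_factorial_one:
  "poly (pderiv (\<Prod>i<Suc (Suc k). [:- real i, 1:])) 1 = (-1) ^ k * fact k"
proof (induction k)
  case 0
  show ?case by (simp add: pderiv_mult pderiv_pCons)
next
  case (Suc k)
  let ?P = "\<Prod>i<Suc (Suc k). [:- real i, 1:]"
  have zero: "poly ?P 1 = 0" by (simp add: poly_prod prod.lessThan_Suc_shift del: prod.lessThan_Suc)
  have "poly (pderiv (p * [:- c, 1:])) 1 = poly (pderiv p) 1 * (1 - c) + poly p 1" for p and c :: real
    unfolding pderiv_mult by (simp add: pderiv_pCons algebra_simps)
  from this[of ?P "real (Suc (Suc k))", unfolded zero add_0_right]
  have "poly (pderiv (?P * [:- real (Suc (Suc k)), 1:])) 1 = poly (pderiv ?P) 1 * (1 - real (Suc (Suc k)))" .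
  also have "\<dots> = (-1) ^ Suc k * fact (Suc k)" unfolding Suc.IH by (simp add: algebra_simps)
  finally show ?case unfolding prod.lessThan_Suc[of _ "Suc (Suc k)"] .
qed

section \<open>The two inductions over deletion and contraction\<close>

lemma contract_edge_props:
  assumes G: "pair_graph G" and e: "(v, w) \<in> parcs G"
  shows "pverts (delete_edge G v w) = pverts G"
    and "pverts (contract_edge G v w) = pverts G - {w}"
    and "card (pverts G) = Suc (card (pverts (contract_edge G v w)))"
    and "card (parcs (delete_edge G v w)) < card (parcs G)"
    and "card (parcs (contract_edge G v w)) < card (parcs G)"
proof -
  have fin: "finite (parcs G)" "finite (pverts G)" and w: "w \<in> pverts G"
    using G e by (auto simp: pair_graph_iff intro: finite_subset)
  show "pverts (delete_edge G v w) = pverts G" by (simp add: delete_edge_def)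
  show K: "pverts (contract_edge G v w) = pverts G - {w}" by (simp add: contract_edge_def)
  show "card (pverts G) = Suc (card (pverts (contract_edge G v w)))"
    unfolding K by (rule card.remove[OF fin(2) w])
  show less: "card (parcs (delete_edge G v w)) < card (parcs G)"
    using fin(1) e by (intro psubset_card_mono) (auto simp: delete_edge_def)
  have "finite (parcs (delete_edge G v w))" using fin(1) by (simp add: delete_edge_def)
  then show "card (parcs (contract_edge G v w)) < card (parcs G)"
    unfolding parcs_contract_edge using card_image_le less by (metis le_less_trans)
qed

lemma clique_contract_edge:
  assumes w: "w \<notin> B" and clique: "\<And>i j. i \<in> B \<Longrightarrow> j \<in> B \<Longrightarrow> i \<noteq> j \<Longrightarrow> (i, j) \<in> parcs G"
    and ij: "i \<in> B" "j \<in> B" "i \<noteq> j"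
  shows "(i, j) \<in> parcs (delete_edge G v w)" "(i, j) \<in> parcs (contract_edge G v w)"
proof -
  show e: "(i, j) \<in> parcs (delete_edge G v w)"
    using clique[OF ij] w ij by (auto simp: parcs_delete_edge_iff)
  have "merge v w i = i" "merge v w j = j" using w ij by (auto simp: merge_def)
  with parcs_contract_edgeI[OF e] show "(i, j) \<in> parcs (contract_edge G v w)" by simp
qed

text \<open>Contraction lowers the number of vertices by one, so the sign turns the difference of
  chromatic polynomials into the sum of the counts. An isolated vertex outside \<open>B\<close>
  leaves the count unchanged and contributes a factor \<open>-1\<close> at \<open>-1\<close>, which
  the sign absorbs.\<close>

lemma card_ordered_orientations_eq:
  assumes "pair_graph G" "B \<subseteq> pverts G" "inj_on u B"
    and "\<And>i j. i \<in> B \<Longrightarrow> j \<in> B \<Longrightarrow> i \<noteq> j \<Longrightarrow> (i, j) \<in> parcs G"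
  shows "fact (card B) * real (card (ordered_orientations G B u {}))
       = (-1) ^ card (pverts G) * poly (chromatic_poly G) (-1)"
  using assms
\<comment> \<open>The measure includes the vertices because removing an isolated vertex does not
  change the arcs.\<close>
proof (induction "card (parcs G) + card (pverts G)" arbitrary: G rule: less_induct)
  case less
  note G = less.prems(1) and B = less.prems(2) and u = less.prems(3) and clique = less.prems(4)
  have wf: "i \<in> pverts G \<and> j \<in> pverts G \<and> i \<noteq> j \<and> (j, i) \<in> parcs G" if "(i, j) \<in> parcs G" for i j
    using that G by (auto simp: pair_graph_iff irrefl_def sym_def)
  have finV: "finite (pverts G)" using G by (simp add: pair_graph_iff)
  \<comment> \<open>By symmetry, any edge not contained in \<open>B\<close> can be written with its
    second end outside \<open>B\<close>. That end disappears on contraction, so \<open>B\<close>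
    stays intact.\<close>
  consider (edge) v w where "(v, w) \<in> parcs G" "w \<notin> B"
    | (isolated) w where "w \<in> pverts G" "w \<notin> B" "\<And>y. (w, y) \<notin> parcs G" "\<And>y. (y, w) \<notin> parcs G"
    | (complete) "pverts G = B" "parcs G = {(i, j). i \<in> B \<and> j \<in> B \<and> i \<noteq> j}"
  proof (cases "\<exists>v w. (v, w) \<in> parcs G \<and> w \<notin> B")
    case True
    then show ?thesis using edge by blast
  next
    case no: False
    show ?thesis
    proof (cases "pverts G = B")
      case True
      have "parcs G = {(i, j). i \<in> B \<and> j \<in> B \<and> i \<noteq> j}"
        by (intro equalityI subrelI) (use True clique wf in blast)+
      with True show ?thesis by (rule complete)
    next
      case False
      with B obtain w where w: "w \<in> pverts G" "w \<notin> B" by blast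
      with no wf isolated[OF w] show ?thesis by blast
    qed
  qed
  then show ?case
  proof cases
    case (edge v w)
    note p = contract_edge_props[OF G edge(1)]
    let ?H = "delete_edge G v w" and ?K = "contract_edge G v w"
    have "fact (card B) * real (card (ordered_orientations ?H B u {}))
        = (-1) ^ card (pverts ?H) * poly (chromatic_poly ?H) (-1)"
      using p B u clique_contract_edge[OF edge(2) clique]
      by (intro less.hyps pair_graph_delete_edge[OF G]) auto
    moreover have "fact (card B) * real (card (ordered_orientations ?K B u {}))
        = (-1) ^ card (pverts ?K) * poly (chromatic_poly ?K) (-1)"
      using p B u edge(2) clique_contract_edge[OF edge(2) clique]
      by (intro less.hyps pair_graph_contract_edge[OF G edge(1)]) auto
    moreover have "card (ordered_orientations G B u {})
        = card (ordered_orientations ?H B u {}) + card (ordered_orientations ?K B u {})"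
      using card_ordered_orientations_delete_contract[OF G edge clique, of "{}" u] by simp
    ultimately show ?thesis
      unfolding chromatic_poly_delete_contract[OF G edge(1)] p(1,3) by (simp add: algebra_simps)
  next
    case (isolated w)
    let ?H = "delete_vertex G w"
    have V: "pverts ?H = pverts G - {w}" and E: "parcs ?H = parcs G"
      using isolated by (auto simp: delete_vertex_def)
    have n: "card (pverts G) = Suc (card (pverts ?H))"
      unfolding V by (rule card.remove[OF finV isolated(1)])
    have "fact (card B) * real (card (ordered_orientations ?H B u {}))
        = (-1) ^ card (pverts ?H) * poly (chromatic_poly ?H) (-1)"
    proof (rule less.hyps)
      show "card (parcs ?H) + card (pverts ?H) < card (parcs G) + card (pverts G)"
        unfolding n E by simp
      show "B \<subseteq> pverts ?H" using isolated(2) B V by blast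
    qed (use clique E in \<open>simp_all add: pair_graph_delete_vertex[OF G] u\<close>)
    moreover have "ordered_orientations ?H B u {} = ordered_orientations G B u {}"
      by (simp add: ordered_orientations_def acyclic_orientations_def orientations_def E)
    moreover have "chromatic_poly G = [:0, 1:] * chromatic_poly ?H"
    proof -
      have "chromatic_poly G = [:- real (card (parcs G `` {w})), 1:] * chromatic_poly ?H"
        by (rule chromatic_poly_simplicial_vertex[OF G isolated(1)]) (use isolated(3) in blast)
      moreover have "parcs G `` {w} = {}" using isolated(3) by blast
      ultimately show ?thesis by simp
    qed
    ultimately show ?thesis unfolding n by simp
  next
    case complete
    have "G = \<lparr> pverts = B, parcs = {(i, j). i \<in> B \<and> j \<in> B \<and> i \<noteq> j} \<rparr>"
      using complete by (intro pair_pre_digraph_eqI) simp_all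
    then have "chromatic_poly G = (\<Prod>i<card B. [:- real i, 1:])"
      using chromatic_poly_complete[of B] finV complete(1) by simp
    then show ?thesis
      using ordered_orientations_complete[OF complete(2) u] complete(1)
      by (simp add: poly_falling_factorial_minus_one flip: mult.assoc power_add)
  qed
qed

text \<open>
  The hypothesis that no vertex outside \<open>B\<close> is isolated is kept by deletion and contraction as long as there
  are no vertices of degree 1 outside \<open>B\<close>; if there is one, both sides vanish.
\<close>

lemma card_ordered_orientations_no_sink_source_eq:
  assumes "pair_graph G" "B \<subseteq> pverts G" "inj_on u B" "card B \<ge> 2"
    and "\<And>i j. i \<in> B \<Longrightarrow> j \<in> B \<Longrightarrow> i \<noteq> j \<Longrightarrow> (i, j) \<in> parcs G"
    and "\<And>x. x \<in> pverts G - B \<Longrightarrow> \<exists>y. (x, y) \<in> parcs G"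
  shows "fact (card B - 2) * real (card (ordered_orientations G B u (pverts G - B)))
       = (-1) ^ card (pverts G) * poly (pderiv (chromatic_poly G)) 1"
  using assms
\<comment> \<open>The arcs suffice as a measure here: the induction hypothesis is used for deletion
  and contraction only, the leaf case being settled directly.\<close>
proof (induction "card (parcs G)" arbitrary: G rule: less_induct)
  case less
  note G = less.prems(1) and B = less.prems(2) and u = less.prems(3) and m = less.prems(4)
    and clique = less.prems(5) and noniso = less.prems(6)
  have wf: "i \<in> pverts G \<and> j \<in> pverts G \<and> i \<noteq> j \<and> (j, i) \<in> parcs G" if "(i, j) \<in> parcs G" for i j
    using that G by (auto simp: pair_graph_iff irrefl_def sym_def)
  have finV: "finite (pverts G)" using G by (simp add: pair_graph_iff)
  consider (leaf) v w where "w \<in> pverts G - B" "parcs G `` {w} = {v}"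
    | (edge) v w where "(v, w) \<in> parcs G" "w \<notin> B" "\<And>x z. x \<in> pverts G - B \<Longrightarrow> \<exists>y. (x, y) \<in> parcs G \<and> y \<noteq> z"
    | (complete) "pverts G = B" "parcs G = {(i, j). i \<in> B \<and> j \<in> B \<and> i \<noteq> j}"
  proof (cases "\<exists>v. \<exists>w \<in> pverts G - B. parcs G `` {w} = {v}")
    case True
    then show ?thesis using leaf by blast
  next
    case no_leaf: False
    have two: "\<exists>y. (x, y) \<in> parcs G \<and> y \<noteq> z" if "x \<in> pverts G - B" for x z
    proof (rule ccontr)
      assume "\<not> (\<exists>y. (x, y) \<in> parcs G \<and> y \<noteq> z)"
      with noniso[OF that] have "parcs G `` {x} = {z}" by auto
      with no_leaf that show False by blast
    qed
    show ?thesis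
    proof (cases "pverts G = B")
      case True
      have "parcs G = {(i, j). i \<in> B \<and> j \<in> B \<and> i \<noteq> j}"
        by (intro equalityI subrelI) (use True clique wf in blast)+
      with True show ?thesis by (rule complete)
    next
      case False
      with B obtain w where w: "w \<in> pverts G" "w \<notin> B" by blast
      with noniso obtain v where "(w, v) \<in> parcs G" by blast
      with wf w two show ?thesis using edge by blast
    qed
  qed
  then show ?case
  proof cases
    case (leaf v w)
    let ?H = "delete_vertex G w"
    have nb: "(w, y) \<in> parcs G \<Longrightarrow> y = v" for y using leaf(2) by auto
    \<comment> \<open>The only edge at the leaf points either in or out, which makes the leaf a
      source or a sink.\<close>
    have "D \<notin> ordered_orientations G B u (pverts G - B)" for D
    proof
      assume "D \<in> ordered_orientations G B u (pverts G - B)"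
      then have o: "D \<in> orientations G" and "\<not> is_sink D w" "\<not> is_source D w"
        using leaf(1) by (auto simp: ordered_orientations_iff)
      then obtain y z where yz: "(w, y) \<in> D" "(z, w) \<in> D" by (auto simp: is_sink_def is_source_def)
      have "y = v" using orientations_parcs[OF o yz(1)] by (rule nb)
      moreover have "z = v" using wf[OF orientations_parcs[OF o yz(2)]] nb by blast
      ultimately show False using yz orientations_asym[OF o, of w v] by blast
    qed
    then have "ordered_orientations G B u (pverts G - B) = {}" by blast
    \<comment> \<open>Two adjacent vertices of \<open>B\<close> survive in \<open>?H\<close>, so its
      chromatic polynomial vanishes at 1; the factor contributed by the leaf makes 1 a double
      root.\<close>
    moreover have "poly (pderiv (chromatic_poly G)) 1 = 0"
    proof -
      have "\<exists>i\<in>B. \<exists>j\<in>B. i \<noteq> j"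
        using m by (metis card_le_Suc0_iff_eq not_less_eq_eq numeral_2_eq_2 B finV finite_subset)
      then obtain i j where ij: "i \<in> B" "j \<in> B" "i \<noteq> j" by blast
      then have "(i, j) \<in> parcs ?H" using clique leaf(1) by (auto simp: delete_vertex_def)
      moreover have "i \<in> pverts ?H" "j \<in> pverts ?H" using ij B leaf(1) by (auto simp: delete_vertex_def)
      ultimately have "proper_colorings ?H 1 = {}"
        by (fastforce simp: proper_colorings_iff PiE_iff)
      then have "poly (chromatic_poly ?H) 1 = 0"
        using poly_chromatic_poly[OF pair_graph_delete_vertex[OF G], of w 1] by simp
      moreover have "chromatic_poly G = [:-1, 1:] * chromatic_poly ?H"
      proof -
        have "chromatic_poly G = [:- real (card (parcs G `` {w})), 1:] * chromatic_poly ?H"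
          by (rule chromatic_poly_simplicial_vertex[OF G]) (use leaf(1) nb in blast)+
        then show ?thesis unfolding leaf(2) by simp
      qed
      ultimately show ?thesis by (simp add: pderiv_diff pderiv_pCons)
    qed
    ultimately show ?thesis by simp
  next
    case (edge v w)
    note p = contract_edge_props[OF G edge(1)]
    let ?H = "delete_edge G v w" and ?K = "contract_edge G v w"
    let ?S = "pverts G - B"
    have nonisoH: "\<exists>y. (x, y) \<in> parcs ?H" if x: "x \<in> ?S" for x
    proof -
      \<comment> \<open>The avoided neighbor is the other end of the deleted edge when
        \<open>x\<close> is \<open>v\<close> or \<open>w\<close>; for all other \<open>x\<close> the
        choice is harmless.\<close>
      obtain y where "(x, y) \<in> parcs G" "y \<noteq> (if x = v then w else v)"
        using edge(3)[OF x, of "if x = v then w else v"] by blast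
      then have "(x, y) \<in> parcs ?H" by (auto simp: parcs_delete_edge_iff split: if_splits)
      then show ?thesis ..
    qed
    have "fact (card B - 2) * real (card (ordered_orientations ?H B u (pverts ?H - B)))
        = (-1) ^ card (pverts ?H) * poly (pderiv (chromatic_poly ?H)) 1"
      using p B u m nonisoH clique_contract_edge[OF edge(2) clique]
      by (intro less.hyps pair_graph_delete_edge[OF G]) auto
    moreover have "fact (card B - 2) * real (card (ordered_orientations ?K B u (pverts ?K - B)))
        = (-1) ^ card (pverts ?K) * poly (pderiv (chromatic_poly ?K)) 1"
    proof (rule less.hyps)
      fix x assume x: "x \<in> pverts ?K - B"
      then obtain y where "(x, y) \<in> parcs ?H" using nonisoH[of x] unfolding p(2) by blast
      from parcs_contract_edgeI[OF this] x show "\<exists>y. (x, y) \<in> parcs ?K"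
        unfolding p(2) by (auto simp: merge_def)
    qed (use p B u m edge(2) clique_contract_edge[OF edge(2) clique] pair_graph_contract_edge[OF G edge(1)] in auto)
    moreover have "card (ordered_orientations G B u ?S)
        = card (ordered_orientations ?H B u ?S) + card (ordered_orientations ?K B u (?S - {w}))"
      using nonisoH wf[OF edge(1)] edge(2)
      by (intro card_ordered_orientations_delete_contract[OF G edge(1,2) clique]) auto
    moreover have "?S - {w} = pverts ?K - B" unfolding p(2) by blast
    ultimately show ?thesis
      unfolding chromatic_poly_delete_contract[OF G edge(1)] pderiv_diff p(1,3) by (simp add: algebra_simps)
  next
    case complete
    have "G = \<lparr> pverts = B, parcs = {(i, j). i \<in> B \<and> j \<in> B \<and> i \<noteq> j} \<rparr>"
      using complete by (intro pair_pre_digraph_eqI) simp_all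
    then have "chromatic_poly G = (\<Prod>i<card B. [:- real i, 1:])"
      using chromatic_poly_complete[of B] finV complete(1) by simp
    \<comment> \<open>As \<open>card B\<close> and \<open>k\<close> have the same parity, the two
      signs cancel.\<close>
    moreover obtain k where k: "card B = Suc (Suc k)" using m by (auto dest: le_Suc_ex)
    ultimately have "poly (pderiv (chromatic_poly G)) 1 = (-1) ^ k * fact k"
      using poly_pderiv_falling_factorial_one[of k] by simp
    then show ?thesis
      using ordered_orientations_complete[OF complete(2) u] complete(1) k
      by (simp flip: mult.assoc power_add)
  qed
qed

subsection \<open>Compatible orientations\<close>

lemma pair_graph_add_clique:
  "pair_graph G \<Longrightarrow> B \<subseteq> pverts G \<Longrightarrow> pair_graph (add_clique G B)"
  unfolding pair_graph_iff add_clique_def by (auto simp: sym_def irrefl_def)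

text \<open>A path of \<open>D\<close> violating the order closes up to a cycle with one added arc.
  Conversely, if \<open>D\<close> respects \<open>u\<close>, its paths between elements of
  \<open>B\<close> never increase \<open>u\<close>, so a cycle cannot make up for the strict descent
  along an added arc.\<close>

lemma acyclic_Un_decreasing_iff:
  assumes u: "inj_on u B"
  shows "acyclic (D \<union> {(i, j). i \<in> B \<and> j \<in> B \<and> u j < u i}) \<longleftrightarrow> acyclic D \<and> respects_values D B u"
    (is "acyclic (D \<union> ?T) \<longleftrightarrow> _")
proof
  assume ac: "acyclic (D \<union> ?T)"
  then have "acyclic D" by (rule acyclic_subset) auto
  moreover have "u j < u i" if ij: "i \<in> B" "j \<in> B" "i \<noteq> j" "(i, j) \<in> D\<^sup>+" for i j
  proof (rule ccontr)
    assume "\<not> u j < u i"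
    moreover have "u i \<noteq> u j" using u ij(1-3) by (simp add: inj_on_eq_iff)
    ultimately have "(j, i) \<in> ?T" using ij(1,2) by simp
    moreover have "(i, j) \<in> (D \<union> ?T)\<^sup>+" using ij(4) by (rule trancl_mono) auto
    ultimately have "(i, i) \<in> (D \<union> ?T)\<^sup>+" by (meson UnI2 trancl_into_trancl)
    then show False using acyclicD[OF ac] by blast
  qed
  ultimately show "acyclic D \<and> respects_values D B u" by (auto simp: respects_values_def)
next
  assume "acyclic D \<and> respects_values D B u"
  then have ac: "acyclic D" and resp: "respects_values D B u" by auto
  have le: "u j \<le> u i" if "(i, j) \<in> D\<^sup>*" "i \<in> B" "j \<in> B" for i j
    using that resp by (auto simp: respects_values_def rtrancl_eq_or_trancl intro: less_imp_le)
  \<comment> \<open>Normal form of a path: all added arcs, with the paths of \<open>D\<close>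
    between them, are compressed into a single descent from \<open>b\<close> to
    \<open>b'\<close>.\<close>
  have path: "(x, y) \<in> D\<^sup>+ \<or> (\<exists>b\<in>B. \<exists>b'\<in>B. (x, b) \<in> D\<^sup>* \<and> u b' < u b \<and> (b', y) \<in> D\<^sup>*)"
    if "(x, y) \<in> (D \<union> ?T)\<^sup>+" for x y
    using that
  proof (induction rule: trancl_induct)
    case (base y)
    then show ?case by blast
  next
    case (step y z)
    show ?case
    proof (cases "(y, z) \<in> D")
      case True
      with step.IH show ?thesis by (meson rtrancl.rtrancl_into_rtrancl trancl.trancl_into_trancl)
    next
      case False
      with step.hyps have yz: "y \<in> B" "z \<in> B" "u z < u y" by auto
      from step.IH show ?thesis
      proof (elim disjE bexE conjE)
        assume "(x, y) \<in> D\<^sup>+"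
        then have "(x, y) \<in> D\<^sup>*" by (rule trancl_into_rtrancl)
        with yz show ?thesis by blast
      next
        fix b b' assume b: "b \<in> B" "b' \<in> B" "(x, b) \<in> D\<^sup>*" "u b' < u b" "(b', y) \<in> D\<^sup>*"
        with le[of b' y] yz have "u z < u b" by simp
        with b yz show ?thesis by blast
      qed
    qed
  qed
  have "(x, x) \<notin> (D \<union> ?T)\<^sup>+" for x
  proof
    assume "(x, x) \<in> (D \<union> ?T)\<^sup>+"
    from path[OF this] acyclicD[OF ac] obtain b b'
      where b: "b \<in> B" "b' \<in> B" "(x, b) \<in> D\<^sup>*" "u b' < u b" "(b', x) \<in> D\<^sup>*" by blast
    then have "(b', b) \<in> D\<^sup>*" by (meson rtrancl_trans)
    with le b show False by fastforce
  qed
  then show "acyclic (D \<union> ?T)" by (simp add: acyclic_def)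
qed

text \<open>Since \<open>B\<close> is independent in \<open>G\<close>, intersecting with
  \<open>parcs G\<close> undoes the union; in the other direction, the order condition forces every
  clique edge to be directed as in the added set.\<close>

lemma bij_betw_semicompatible_ordered:
  assumes G: "pair_graph G" and indep: "B \<times> B \<inter> parcs G = {}" and u: "inj_on u B"
  shows "bij_betw (\<lambda>D. D \<union> {(i, j). i \<in> B \<and> j \<in> B \<and> u j < u i})
           (semicompatible_orientations G B u) (ordered_orientations (add_clique G B) B u {})"
    (is "bij_betw (\<lambda>D. D \<union> ?T) ?X ?Y")
proof (rule bij_betw_byWitness[where f' = "\<lambda>D. D \<inter> parcs G"])
  let ?H = "add_clique G B"
  have H: "(i, j) \<in> parcs ?H \<longleftrightarrow> (i, j) \<in> parcs G \<or> i \<in> B \<and> j \<in> B \<and> i \<noteq> j" for i j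
    by (simp add: add_clique_def)
  have T: "?T \<inter> parcs G = {}" using indep by auto
  show "\<forall>D\<in>?X. (D \<union> ?T) \<inter> parcs G = D"
    using T by (auto simp: semicompatible_orientations_def dest: orientations_parcs)
  have restore: "D \<inter> parcs G \<union> ?T = D" if D: "D \<in> ?Y" for D
  proof -
    have o: "D \<in> orientations ?H" and ord: "\<And>i j. i \<in> B \<Longrightarrow> j \<in> B \<Longrightarrow> (i, j) \<in> D \<Longrightarrow> u j < u i"
      using D by (auto simp: ordered_orientations_iff)
    have "(i, j) \<in> D" if "(i, j) \<in> ?T" for i j
    proof (rule ccontr)
      assume "(i, j) \<notin> D"
      moreover have "(i, j) \<in> parcs ?H" using that by (auto simp: H)
      ultimately have "(j, i) \<in> D" by (intro orientations_total[OF o])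
      then show False using ord[of j i] that by auto
    qed
    moreover have "(i, j) \<in> parcs G \<or> (i, j) \<in> ?T" if "(i, j) \<in> D" for i j
      using orientations_parcs[OF o that] ord[of i j] that by (auto simp: H)
    ultimately show ?thesis by (intro equalityI subrelI) blast+
  qed
  then show "\<forall>D\<in>?Y. D \<inter> parcs G \<union> ?T = D" by blast
  show "(\<lambda>D. D \<union> ?T) ` ?X \<subseteq> ?Y"
  proof (rule image_subsetI)
    fix D assume D: "D \<in> ?X"
    then have o: "D \<in> orientations G" by (simp add: semicompatible_orientations_def)
    have noB: "\<not> (i \<in> B \<and> j \<in> B)" if "(i, j) \<in> D" for i j
      using indep orientations_parcs[OF o that] by blast
    have "D \<union> ?T \<in> orientations ?H"
    proof (rule orientationsI)
      show "D \<union> ?T \<subseteq> parcs ?H" using orientations_parcs[OF o] by (auto simp: H)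
      show "(j, i) \<in> D \<union> ?T" if ij: "(i, j) \<in> parcs ?H" "(i, j) \<notin> D \<union> ?T" for i j
      proof (cases "(i, j) \<in> parcs G")
        case True
        then show ?thesis using ij(2) orientations_total[OF o True] by blast
      next
        case False
        with ij have "i \<in> B" "j \<in> B" "i \<noteq> j" "\<not> u j < u i" by (auto simp: H)
        moreover from this have "u i \<noteq> u j" using u by (simp add: inj_on_eq_iff)
        ultimately show ?thesis by simp
      qed
      show "(j, i) \<notin> D \<union> ?T" if "(i, j) \<in> D \<union> ?T" for i j
        using that noB[of i j] noB[of j i] orientations_asym[OF o, of i j] by auto
    qed
    moreover have "acyclic (D \<union> ?T)"
      using D by (simp add: acyclic_Un_decreasing_iff[OF u] semicompatible_orientations_def)
    ultimately show "D \<union> ?T \<in> ?Y" using noB by (auto simp: ordered_orientations_iff)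
  qed
  show "(\<lambda>D. D \<inter> parcs G) ` ?Y \<subseteq> ?X"
  proof (rule image_subsetI)
    fix D assume D: "D \<in> ?Y"
    then have o: "D \<in> orientations ?H" and ac: "acyclic D" by (auto simp: ordered_orientations_iff)
    have "D \<inter> parcs G \<in> orientations G"
    proof (rule orientationsI)
      show "(j, i) \<notin> D \<inter> parcs G" if "(i, j) \<in> D \<inter> parcs G" for i j
        using that orientations_asym[OF o, of i j] by blast
      show "(j, i) \<in> D \<inter> parcs G" if "(i, j) \<in> parcs G" "(i, j) \<notin> D \<inter> parcs G" for i j
        using that orientations_total[OF o, of i j] G by (auto simp: H pair_graph_iff sym_def)
    qed auto
    moreover have "acyclic (D \<inter> parcs G \<union> ?T)" unfolding restore[OF D] by (rule ac)
    ultimately show "D \<inter> parcs G \<in> ?X"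
      by (simp add: acyclic_Un_decreasing_iff[OF u] semicompatible_orientations_def)
  qed
qed

text \<open>Arcs inside \<open>B\<close> do not affect sinks and sources outside \<open>B\<close>,
  so the previous bijection restricts.\<close>

lemma bij_betw_compatible_ordered:
  assumes G: "pair_graph G" and indep: "B \<times> B \<inter> parcs G = {}" and u: "inj_on u B"
  shows "bij_betw (\<lambda>D. D \<union> {(i, j). i \<in> B \<and> j \<in> B \<and> u j < u i})
           (compatible_orientations G B u) (ordered_orientations (add_clique G B) B u (pverts G - B))"
    (is "bij_betw (\<lambda>D. D \<union> ?T) ?X ?Y")
proof -
  let ?P = "\<lambda>D. \<forall>v\<in>pverts G - B. \<not> is_sink D v \<and> \<not> is_source D v"
  note bij = bij_betw_semicompatible_ordered[OF G indep u]
  have "is_sink (D \<union> ?T) v \<longleftrightarrow> is_sink D v" "is_source (D \<union> ?T) v \<longleftrightarrow> is_source D v" if "v \<in> pverts G - B" for D v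
    using that by (auto simp: is_sink_def is_source_def)
  then have P: "?P (D \<union> ?T) \<longleftrightarrow> ?P D" for D by blast
  have X: "?X = {D \<in> semicompatible_orientations G B u. ?P D}"
    by (simp add: compatible_orientations_def)
  have Y: "?Y = {D \<in> ordered_orientations (add_clique G B) B u {}. ?P D}"
    by (auto simp: ordered_orientations_iff)
  have "(\<lambda>D. D \<union> ?T) ` ?X = {D' \<in> (\<lambda>D. D \<union> ?T) ` semicompatible_orientations G B u. ?P D'}"
    unfolding X using P by blast
  then have "(\<lambda>D. D \<union> ?T) ` ?X = ?Y"
    unfolding bij_betw_imp_surj_on[OF bij] Y .
  moreover have "inj_on (\<lambda>D. D \<union> ?T) ?X"
    unfolding X by (rule inj_on_subset[OF bij_betw_imp_inj_on[OF bij]]) blast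
  ultimately show ?thesis by (rule bij_betw_imageI[rotated])
qed

lemma connected_not_isolated:
  assumes G: "pair_graph G" and con: "Digraph_Component.connected (with_proj G)"
    and xy: "x \<in> pverts G" "y \<in> pverts G" "x \<noteq> y"
  shows "\<exists>z. (x, z) \<in> parcs G"
proof -
  interpret pair_graph G by fact
  \<comment> \<open>Connectedness is defined through the symmetric closure, whose arcs lead back to
    \<open>G\<close> by symmetry. The first arc of a path to \<open>y\<close> is the one
    sought.\<close>
  have "x \<rightarrow>\<^sup>*\<^bsub>with_proj (mk_symmetric (with_proj G))\<^esub> y"
    using con xy by (auto simp: connected_def strongly_connected_def)
  then have "(x, y) \<in> (parcs (mk_symmetric (with_proj G)))\<^sup>*"
    unfolding reachable_def by (auto dest: rtrancl_on_rtranclI)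
  then obtain z where "(x, z) \<in> parcs (mk_symmetric (with_proj G))"
    using xy(3) by (auto elim: converse_rtranclE)
  then have "(x, z) \<in> parcs G \<or> (z, x) \<in> parcs G" by (auto simp: parcs_mk_symmetric)
  then show ?thesis using G unfolding pair_graph_iff sym_def by blast
qed

theorem theorem3p17:
  fixes G :: "'a pair_pre_digraph" and B :: "'a set" and m :: nat and u :: "'a \<Rightarrow> real"
  assumes "pair_graph G"
    and "Digraph_Component.connected (with_proj G)"
    and "B \<subset> pverts G"
    and "card B = m" and "m \<ge> 2"
    and "\<And>i j. i \<in> B \<Longrightarrow> j \<in> B \<Longrightarrow> (i, j) \<notin> parcs G"
    and "inj_on u B"
  shows "real (card (semicompatible_orientations G B u))
           = real (card (acyclic_orientations (add_clique G B))) / fact m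
       \<and> real (card (compatible_orientations G B u))
           = beta_invariant (add_clique G B) / fact (m - 2)"
proof
  let ?H = "add_clique G B"
  note G = assms(1) and m = assms(4,5) and u = assms(7)
  have indep: "B \<times> B \<inter> parcs G = {}" using assms(6) by blast
  have B: "B \<subseteq> pverts ?H" "B \<subseteq> pverts G" using assms(3) by (auto simp: add_clique_def)
  note H = pair_graph_add_clique[OF G B(2)]
  have clique: "(i, j) \<in> parcs ?H" if "i \<in> B" "j \<in> B" "i \<noteq> j" for i j
    using that by (simp add: add_clique_def)
  have "acyclic_orientations ?H = ordered_orientations ?H {} u {}"
    by (simp add: ordered_orientations_def)
  \<comment> \<open>Both sides equal the same signed value of the chromatic polynomial at
    \<open>-1\<close>: once with \<open>B\<close>, once with the empty clique, whose factorial is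
    1.\<close>
  then have "fact m * real (card (ordered_orientations ?H B u {})) = real (card (acyclic_orientations ?H))"
    using card_ordered_orientations_eq[OF H B(1) u clique] card_ordered_orientations_eq[OF H, of "{}" u] m
    by simp
  then show "real (card (semicompatible_orientations G B u)) = real (card (acyclic_orientations ?H)) / fact m"
    unfolding bij_betw_same_card[OF bij_betw_semicompatible_ordered[OF G indep u]]
    by (simp add: field_simps)
  have "\<exists>y. (x, y) \<in> parcs ?H" if "x \<in> pverts ?H - B" for x
  proof -
    obtain b where b: "b \<in> B" using m by fastforce
    with that B have "\<exists>y. (x, y) \<in> parcs G"
      by (intro connected_not_isolated[OF G assms(2), of _ b]) (auto simp: add_clique_def)
    then show ?thesis by (auto simp: add_clique_def)
  qed
  then have "fact (m - 2) * real (card (ordered_orientations ?H B u (pverts ?H - B)))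
      = (-1) ^ card (pverts ?H) * poly (pderiv (chromatic_poly ?H)) 1"
    using card_ordered_orientations_no_sink_source_eq[OF H B(1) u _ clique] m by simp
  \<comment> \<open>Absolute values remove the sign on the right, while the count on the left is
    nonnegative.\<close>
  then have "\<bar>fact (m - 2) * real (card (ordered_orientations ?H B u (pverts ?H - B)))\<bar> = beta_invariant ?H"
    by (simp only: beta_invariant_def abs_mult power_abs) simp
  then have "fact (m - 2) * real (card (ordered_orientations ?H B u (pverts ?H - B))) = beta_invariant ?H"
    by simp
  moreover have "pverts ?H = pverts G" by (simp add: add_clique_def)
  ultimately show "real (card (compatible_orientations G B u)) = beta_invariant ?H / fact (m - 2)"
    unfolding bij_betw_same_card[OF bij_betw_compatible_ordered[OF G indep u]]
    by (simp add: field_simps)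
qed

end
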